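(* Consider the two-operator network ($\mathcal{O}=\{1,2\}$, typical UE subscribed to operator $n=1$) of the context, using a receiver carrier sensing (CSR) scheme with transmission probability $p_{\mathbb{T}}$ and with exclusion zones $\mathcal{R}_{L,h}=B_0(h_L)$, $\mathcal{R}_{N,h}=B_0(h_N)$, $\mathcal{R}_{L,d}=B_0(d_L)$, $\mathcal{R}_{N,d}=B_0(d_N)$. Let $r>0$, $Z>0$, $s_L=\frac{r^{\alpha_L}Z}{C_LM_{BS}M_{UE}}$, $s_N=\frac{r^{\alpha_N}Z}{C_NM_{BS}M_{UE}}$. For $\mathcal{S}\in\{\{1\},\{1,2\}\}$ let $\mathcal{L}^{\mathcal{S}}_{I(L_{\mathcal{S}})}$, $\mathcal{L}^{\mathcal{S}}_{I(N_{\mathcal{S}})}$ denote the Laplace transforms of the normalized interference at the typical UE, given that it is being served and that its serving BS is at distance $r$ on a site of $\Phi_{\mathcal{S}}$ with LoS, respectively NLoS, link. For $\tau\in\{L,N\}$ put $V_\tau(s,t)=(1-u_\tau(s,t))\,t\,p_\tau(t)$ and $W_\tau(s,t)=(1-u_\tau(s,t))(a+\rho u_\tau(s,t))\,t\,p_\tau(t)$. Then $$\mathcal{L}^{\{1\}}_{I(L_{\mathcal{S}})}(s_L)=\exp\Big(-2\pi\lambda\Big[\int_{h_L}^\infty(1-a)V_L(s_L,t)dt+\int_{d_L}^\infty(1-a)V_L(s_L,t)dt+\int_{\max(r,h_L)}^\infty W_L(s_L,t)dt+\int_{\max(r,d_L)}^\infty W_L(s_L,t)dt$$ $$+\int_{h_N}^\infty(1-a)V_N(s_L,t)dt+\int_{d_N}^\infty(1-a)V_N(s_L,t)dt+\int_{\max(D_N(r),h_N)}^\infty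 W_N(s_L,t)dt+\int_{\max(D_N(r),d_N)}^\infty W_N(s_L,t)dt\Big]\Big),$$ $$\mathcal{L}^{\{1,2\}}_{I(L_{\mathcal{S}})}(s_L)=u_{L,h}(s_L,r)\,u_{L,d}(s_L,r)\,\mathcal{L}^{\{1\}}_{I(L_{\mathcal{S}})}(s_L),$$ $$\mathcal{L}^{\{1\}}_{I(N_{\mathcal{S}})}(s_N)=\exp\Big(-2\pi\lambda\Big[\int_{h_N}^\infty(1-a)V_N(s_N,t)dt+\int_{d_N}^\infty(1-a)V_N(s_N,t)dt+\int_{\max(r,h_N)}^\infty W_N(s_N,t)dt+\int_{\max(r,d_N)}^\infty W_N(s_N,t)dt$$ $$+\int_{h_L}^\infty(1-a)V_L(s_N,t)dt+\int_{d_L}^\infty(1-a)V_L(s_N,t)dt+\int_{\max(D_L(r),h_L)}^\infty W_L(s_N,t)dt+\int_{\max(D_L(r),d_L)}^\infty W_L(s_N,t)dt\Big]\Big),$$ $$\mathcal{L}^{\{1,2\}}_{I(N_{\mathcal{S}})}(s_N)=u_{N,h}(s_N,r)\,u_{N,d}(s_N,r)\,\mathcal{L}^{\{1\}}_{I(N_{\mathcal{S}})}(s_N).$$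
   Context: Network. $\Phi_{\{1\}},\Phi_{\{2\}},\Phi_{\{1,2\}}$ are independent homogeneous PPPs in $\mathbb{R}^2$ of densities $\lambda_{\{1\}},\lambda_{\{2\}},\lambda_{\{1,2\}}$: base station (BS) sites used by exactly the indicated operators (one BS per such operator at each site). Operator densities are $\lambda_1=\lambda_{\{1\}}+\lambda_{\{1,2\}}$ and $\lambda_2=\lambda_{\{2\}}+\lambda_{\{1,2\}}$. The overlap coefficient $\rho\in[0,1]$ is such that $\lambda_{\{1,2\}}=\rho\lambda$ with $\lambda=\lambda_1+\lambda_2-\rho\lambda>0$, and $a=\lambda_1/\lambda$; hence $\lambda_{\{1\}}=(a-\rho)\lambda$, $\lambda_{\{2\}}=(1-a)\lambda$. Each site at distance $t$ from the typical UE (at the origin) has, independently, a line-of-sight (LoS) link to the UE with probability $p_L(t)=e^{-\beta t}$, else a non-line-of-sight (NLoS) link, $p_N(t)=1-p_L(t)$. $L_{\mathcal{S}},N_{\mathcal{S}}$ are the LoS and NLoS sub-processes of $\Phi_{\mathcal{S}}$. Path loss at distance $t$ is $C_\tau t^{-\alpha_\tau}$, $\tau\in\{L,N\}$, with positive constants. Association. The UE is served by the operator-1 BS with largest path gain. With serving distance $r$ and a LoS serving link, sites of $\Phi_{\{1\}}\cup\Phi_{\{1,2\}}$ other than the serving site lie at distance $>r$ if LoS and $>D_N(r)$ if NLoS; with a NLoS serving link, they lie at distance $>r$ if NLoS and $>D_L(r)$ if LoS. Here $D_L(r)=(C_L/C_N)^{1/\alpha_L}r^{\alpha_N/\alpha_L}$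 and $D_N(r)=(C_N/C_L)^{1/\alpha_N}r^{\alpha_L/\alpha_N}$. Conditionally on the serving BS, the remaining sites are PPPs of the original intensities restricted to the allowed regions; sites of $\Phi_{\{2\}}$ are not restricted by association. Exclusion zones. $B_0(x)$ is the closed ball of radius $x$ about the origin; $\mathcal{R}_{\tau,h}$ (resp. $\mathcal{R}_{\tau,d}$) is the zone in which, because of carrier sensing, no hidden (resp. deaf) interferer of link type $\tau$ can be present. The radii are nonnegative numbers: $h_\tau=\mathbb{E}\big[(P_XC_\tau A/P_{th})^{1/\alpha_\tau}\big]$, where $P_X$ is the BS transmit power, $P_{th}$ the sensing threshold, and $A$ the sensing antenna gain. For omnidirectional CSR (oCSR), $A=M_{BS}M_{UE}10^{-0.7}$ with probability $\frac{\theta_{BS}}{2\pi}$ and $A=m_{BS}M_{UE}10^{-0.7}$ otherwise; for directional CSR (dCSR) and directional CSR with announcements (dCSRA), $A$ is distributed as the antenna gain $G$ of the interference model. For oCSR and dCSR, $d_L=d_N=0$. For dCSRA, $d_\tau=\mathbb{E}\big[(P_UC_\tau A'/P_{th}^A)^{1/\alpha_\tau}\big]$, with $P_U$ the UE transmit power, $P^A_{th}$ the announcement threshold, and $A'$ distributed as $A$ for oCSR. Interference model. The normalized interference is $I=I_{L,h}+I_{L,d}+I_{N,h}+I_{N,d}$ (LoS hidden, LoS deaf, NLoS hidden, NLoS deaf interferers), and the four components are treated as mutually independent. For $\tau\in\{L,N\}$, $x\in\{h,d\}$, $I_{\tau,x}$ is the sum of $C_\tau K F G\,t^{-\alpha_\tau}$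 over all BSs (one term per BS, so two per site of $\Phi_{\{1,2\}}$) on all non-serving sites with link type $\tau$ that lie in the region allowed by association and outside $\mathcal{R}_{\tau,x}$ ($t$ = distance of the site); in addition, if the serving site is in $\Phi_{\{1,2\}}$, the serving link has type $\tau$, and the serving site is outside $\mathcal{R}_{\tau,x}$, $I_{\tau,x}$ includes the term $C_\tau KFG\,r^{-\alpha_\tau}$ for the co-located operator-2 BS (it shares the link type of the serving BS). All $K,F,G$ are independent of each other, across BSs, and of the sites: $F$ is exponential with mean 1; $K=1$ with probability $p_{\mathbb{T}}/2$ and $K=0$ otherwise, where $p_{\mathbb{T}}\in(0,1]$ is the probability that a BS transmits under the CS scheme; and $G$ takes the values $M_{BS}M_{UE},\ M_{BS}m_{UE},\ m_{BS}M_{UE},\ m_{BS}m_{UE}$ (positive constants) with probabilities $q_1=\frac{\theta_{BS}}{2\pi}\frac{\theta_{UE}}{2\pi}$, $q_2=\frac{\theta_{BS}}{2\pi}(1-\frac{\theta_{UE}}{2\pi})$, $q_3=(1-\frac{\theta_{BS}}{2\pi})\frac{\theta_{UE}}{2\pi}$, $q_4=(1-\frac{\theta_{BS}}{2\pi})(1-\frac{\theta_{UE}}{2\pi})$, where $\theta_{BS},\theta_{UE}\in(0,2\pi]$ are beamwidths. For $\tau\in\{L,N\}$, writing $g_1=M_{BS}M_{UE}$, $g_2=M_{BS}m_{UE}$, $g_3=m_{BS}M_{UE}$, $g_4=m_{BS}m_{UE}$ for the four gain values, $$u_\tau(s,t)=\Big(1-\frac{p_{\mathbb{T}}}{2}\Big)\sum_{i=1}^4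 q_i+\frac{p_{\mathbb{T}}}{2}\sum_{i=1}^4\frac{q_i}{1+sC_\tau g_i t^{-\alpha_\tau}}.$$ For $x\in\{h,d\}$, $u_{\tau,x}(s,t)=1$ if points at distance $t$ from the origin lie in $\mathcal{R}_{\tau,x}$, and $u_{\tau,x}(s,t)=u_\tau(s,t)$ otherwise. *)

theory Defs
  imports "HOL-Probability.Probability"
begin

section \<open>Parameters\<close>

datatype link = LoS | NLoS
datatype interferer = Hidden | Deaf
datatype scheme = oCSR | dCSR | dCSRA

text \<open>
  Operators are the natural numbers 1 and 2; a site class is the set of operators that use
  the site.
\<close>

definition site_classes :: "nat set set" where
  "site_classes = {{1}, {2}, {1, 2}}"

record params =
  dens :: "nat set \<Rightarrow> real"     \<comment> \<open>density of each site class\<close>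
  \<beta> :: real                      \<comment> \<open>LoS decay rate\<close>
  C :: "link \<Rightarrow> real"            \<comment> \<open>path loss constant\<close>
  \<alpha> :: "link \<Rightarrow> real"     \<comment> \<open>path loss exponent\<close>
  M_BS :: real
  m_BS :: real
  M_UE :: real
  m_UE :: real
  \<theta>_BS :: real                  \<comment> \<open>beamwidths\<close>
  \<theta>_UE :: real
  p_T :: real                       \<comment> \<open>transmission probability under carrier sensing\<close>
  P_BS :: real                      \<comment> \<open>BS transmit power\<close>
  P_UE :: real                      \<comment> \<open>UE transmit power\<close>
  P_th :: real                      \<comment> \<open>sensing threshold\<close>
  P_thA :: real                     \<comment> \<open>announcement threshold\<close>

definition valid_params :: "params \<Rightarrow> bool" where
  "valid_params p \<longleftrightarrow>
     (\<forall>S\<in>site_classes. 0 \<le> dens p S) \<and> 0 \<le> \<beta> p \<and>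
     (\<forall>\<tau>. 0 < C p \<tau> \<and> 0 < \<alpha> p \<tau>) \<and>
     0 < M_BS p \<and> 0 < m_BS p \<and> 0 < M_UE p \<and> 0 < m_UE p \<and>
     0 < \<theta>_BS p \<and> \<theta>_BS p \<le> 2 * pi \<and> 0 < \<theta>_UE p \<and> \<theta>_UE p \<le> 2 * pi \<and>
     0 < p_T p \<and> p_T p \<le> 1 \<and>
     0 < P_BS p \<and> 0 < P_UE p \<and> 0 < P_th p \<and> 0 < P_thA p"

definition operator_density :: "params \<Rightarrow> nat \<Rightarrow> real" where
  "operator_density p n = dens p {n} + dens p {1, 2}"

fun link_prob :: "params \<Rightarrow> link \<Rightarrow> real \<Rightarrow> real" where
  "link_prob p LoS t = exp (- \<beta> p * t)"
| "link_prob p NLoS t = 1 - exp (- \<beta> p * t)"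

text \<open>Distributions with finite support, as lists of pairs (value, probability).\<close>

definition gain_dist :: "params \<Rightarrow> (real \<times> real) list" where
  "gain_dist p =
     (let b = \<theta>_BS p / (2 * pi); v = \<theta>_UE p / (2 * pi) in
      [(M_BS p * M_UE p, b * v), (M_BS p * m_UE p, b * (1 - v)),
       (m_BS p * M_UE p, (1 - b) * v), (m_BS p * m_UE p, (1 - b) * (1 - v))])"

definition omni_gain_dist :: "params \<Rightarrow> (real \<times> real) list" where
  "omni_gain_dist p =
     [(M_BS p * M_UE p * 10 powr (-0.7), \<theta>_BS p / (2 * pi)),
      (m_BS p * M_UE p * 10 powr (-0.7), 1 - \<theta>_BS p / (2 * pi))]"

definition transmit_dist :: "params \<Rightarrow> (real \<times> real) list" where
  "transmit_dist p = [(1, p_T p / 2), (0, 1 - p_T p / 2)]"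

section \<open>Exclusion zones and association\<close>

definition sensing_gain_dist :: "params \<Rightarrow> scheme \<Rightarrow> (real \<times> real) list" where
  "sensing_gain_dist p sch = (if sch = oCSR then omni_gain_dist p else gain_dist p)"

fun zone_radius :: "params \<Rightarrow> scheme \<Rightarrow> interferer \<Rightarrow> link \<Rightarrow> real" where
  "zone_radius p sch Hidden \<tau> =
     measure_pmf.expectation (pmf_of_list (sensing_gain_dist p sch))
       (\<lambda>A. (P_BS p * C p \<tau> * A / P_th p) powr (1 / \<alpha> p \<tau>))"
| "zone_radius p sch Deaf \<tau> =
     (if sch = dCSRA
      then measure_pmf.expectation (pmf_of_list (omni_gain_dist p))
             (\<lambda>A. (P_UE p * C p \<tau> * A / P_thA p) powr (1 / \<alpha> p \<tau>))
      else 0)"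

definition zone :: "params \<Rightarrow> scheme \<Rightarrow> link \<Rightarrow> interferer \<Rightarrow> (real^2) set" where
  "zone p sch \<tau> x = cball 0 (zone_radius p sch x \<tau>)"

definition in_zone :: "params \<Rightarrow> scheme \<Rightarrow> link \<Rightarrow> interferer \<Rightarrow> real \<Rightarrow> bool" where
  "in_zone p sch \<tau> x t \<longleftrightarrow> sphere 0 t \<subseteq> zone p sch \<tau> x"

fun D :: "params \<Rightarrow> link \<Rightarrow> real \<Rightarrow> real" where
  "D p LoS r = (C p LoS / C p NLoS) powr (1 / \<alpha> p LoS) * r powr (\<alpha> p NLoS / \<alpha> p LoS)"
| "D p NLoS r = (C p NLoS / C p LoS) powr (1 / \<alpha> p NLoS) * r powr (\<alpha> p LoS / \<alpha> p NLoS)"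

text \<open>
  Region in which a non-serving site of class \<open>S\<close> and link type \<open>\<tau>\<close> may lie when the UE is
  served by operator 1 over a link of type \<open>\<tau>0\<close> and length \<open>r\<close>; classes not used by
  operator 1 are unrestricted.
\<close>

definition allowed :: "params \<Rightarrow> link \<Rightarrow> real \<Rightarrow> nat set \<Rightarrow> link \<Rightarrow> real \<Rightarrow> bool" where
  "allowed p \<tau>0 r S \<tau> t \<longleftrightarrow> (1 \<in> S \<longrightarrow> (if \<tau> = \<tau>0 then r else D p \<tau> r) < t)"

definition u :: "params \<Rightarrow> link \<Rightarrow> real \<Rightarrow> real \<Rightarrow> real" where
  "u p \<tau> s t =
     (1 - p_T p / 2) * (\<Sum>(g, q)\<leftarrow>gain_dist p. q) +
     p_T p / 2 * (\<Sum>(g, q)\<leftarrow>gain_dist p. q / (1 + s * C p \<tau> * g * t powr (- \<alpha> p \<tau>)))"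

definition u_zone :: "params \<Rightarrow> scheme \<Rightarrow> link \<Rightarrow> interferer \<Rightarrow> real \<Rightarrow> real \<Rightarrow> real" where
  "u_zone p sch \<tau> x s t = (if in_zone p sch \<tau> x t then 1 else u p \<tau> s t)"

section \<open>Homogeneous Poisson point processes\<close>

text \<open>
  A point process is given by its random number of points \<open>n \<omega>\<close> (possibly infinite) and an
  enumeration \<open>X 0 \<omega>\<close>, \<open>X 1 \<omega>\<close>, ... of these points. The values \<open>X i \<omega>\<close> with
  \<open>i \<ge> n \<omega>\<close> are not points of the process.
\<close>

definition point_count ::
    "('w \<Rightarrow> enat) \<Rightarrow> (nat \<Rightarrow> 'w \<Rightarrow> real^2) \<Rightarrow> (real^2) set \<Rightarrow> 'w \<Rightarrow> ennreal" where
  "point_count n X B \<omega> = emeasure (count_space UNIV) {i. enat i < n \<omega> \<and> X i \<omega> \<in> B}"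

definition homogeneous_PPP ::
    "'w measure \<Rightarrow> real \<Rightarrow> ('w \<Rightarrow> enat) \<Rightarrow> (nat \<Rightarrow> 'w \<Rightarrow> real^2) \<Rightarrow> bool" where
  "homogeneous_PPP M d n X \<longleftrightarrow>
     n \<in> measurable M (count_space UNIV) \<and> (\<forall>i. X i \<in> borel_measurable M) \<and>
     (\<forall>B\<in>sets borel. bounded B \<longrightarrow>
        (\<forall>k. measure M {\<omega>\<in>space M. point_count n X B \<omega> = of_nat k} =
             (d * measure lborel B) ^ k / fact k * exp (- (d * measure lborel B)))) \<and>
     (\<forall>B (m::nat). (\<forall>i<m. B i \<in> sets borel \<and> bounded (B i)) \<longrightarrow>
        disjoint_family_on B {..<m} \<longrightarrow>
        prob_space.indep_vars M (\<lambda>_. borel) (\<lambda>i. point_count n X (B i)) {..<m})"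

section \<open>Sites, links and marks\<close>

text \<open>
  \<open>BS S i n\<close> is the base station of operator \<open>n\<close> at the \<open>i\<close>-th non-serving site of class
  \<open>S\<close>; \<open>Colocated\<close> is the operator-2 base station at the serving site (relevant only if
  that site has class \<open>{1, 2}\<close>).
\<close>

datatype station = BS "nat set" nat nat | Colocated

definition stations :: "station set" where
  "stations = insert Colocated {BS S i n | S i n. S \<in> site_classes \<and> n \<in> S}"

record 'w network =
  npts :: "nat set \<Rightarrow> 'w \<Rightarrow> enat"
  pos :: "nat set \<Rightarrow> nat \<Rightarrow> 'w \<Rightarrow> real^2"
  link_type :: "nat set \<Rightarrow> nat \<Rightarrow> 'w \<Rightarrow> link"
  K :: "station \<Rightarrow> 'w \<Rightarrow> real"
  F :: "station \<Rightarrow> 'w \<Rightarrow> real"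
  G :: "station \<Rightarrow> 'w \<Rightarrow> real"

definition class_events :: "'w measure \<Rightarrow> 'w network \<Rightarrow> nat set \<Rightarrow> 'w set set" where
  "class_events M N S = sigma_sets (space M)
     ({npts N S -` A \<inter> space M | A. True} \<union>
      {pos N S i -` A \<inter> space M | i A. A \<in> sets borel})"

definition position_events :: "'w measure \<Rightarrow> 'w network \<Rightarrow> 'w set set" where
  "position_events M N = sigma_sets (space M) (\<Union>S\<in>site_classes. class_events M N S)"

definition site_events :: "'w measure \<Rightarrow> 'w network \<Rightarrow> 'w set set" where
  "site_events M N = sigma_sets (space M)
     (position_events M N \<union>
      {link_type N S i -` A \<inter> space M | S i A. S \<in> site_classes})"

datatype source = Sites | K_mark station | F_mark station | G_mark station

fun source_events :: "'w measure \<Rightarrow> 'w network \<Rightarrow> source \<Rightarrow> 'w set set" where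
  "source_events M N Sites = site_events M N"
| "source_events M N (K_mark b) = {K N b -` A \<inter> space M | A. A \<in> sets borel}"
| "source_events M N (F_mark b) = {F N b -` A \<inter> space M | A. A \<in> sets borel}"
| "source_events M N (G_mark b) = {G N b -` A \<inter> space M | A. A \<in> sets borel}"

text \<open>
  The third conjunct states that, conditionally on all positions, the link types are
  independent and a site at distance \<open>t\<close> has link type \<open>\<tau>\<close> with probability
  \<open>link_prob p \<tau> t\<close>.
\<close>

definition is_network :: "'w measure \<Rightarrow> params \<Rightarrow> 'w network \<Rightarrow> bool" where
  "is_network M p N \<longleftrightarrow>
     (\<forall>S\<in>site_classes. homogeneous_PPP M (dens p S) (npts N S) (pos N S)) \<and>
     prob_space.indep_sets M (class_events M N) site_classes \<and>
     (\<forall>S\<in>site_classes. \<forall>i. link_type N S i \<in> measurable M (count_space UNIV)) \<and>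
     (\<forall>J \<sigma>. \<forall>E\<in>position_events M N. finite J \<longrightarrow> J \<subseteq> site_classes \<times> UNIV \<longrightarrow>
        measure M {\<omega>\<in>E. \<forall>(S, i)\<in>J. link_type N S i \<omega> = \<sigma> S i} =
        (LINT \<omega>:E|M. (\<Prod>(S, i)\<in>J. link_prob p (\<sigma> S i) (norm (pos N S i \<omega>))))) \<and>
     (\<forall>b\<in>stations.
        K N b \<in> borel_measurable M \<and>
        distr M borel (K N b) = distr (measure_pmf (pmf_of_list (transmit_dist p))) borel (\<lambda>x. x) \<and>
        distributed M lborel (F N b) (exponential_density 1) \<and>
        G N b \<in> borel_measurable M \<and>
        distr M borel (G N b) = distr (measure_pmf (pmf_of_list (gain_dist p))) borel (\<lambda>x. x)) \<and>
     prob_space.indep_sets M (source_events M N)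
       ({Sites} \<union> K_mark ` stations \<union> F_mark ` stations \<union> G_mark ` stations)"

section \<open>Interference\<close>

definition received :: "params \<Rightarrow> 'w network \<Rightarrow> link \<Rightarrow> station \<Rightarrow> real \<Rightarrow> 'w \<Rightarrow> ennreal" where
  "received p N \<tau> b t \<omega> = ennreal (C p \<tau> * K N b \<omega> * F N b \<omega> * G N b \<omega> * t powr (- \<alpha> p \<tau>))"

text \<open>
  Component \<open>(\<tau>, x)\<close> of the interference when the serving site has class \<open>S0\<close>, link type
  \<open>\<tau>0\<close> and distance \<open>r\<close>. The processes of \<open>N\<close> are homogeneous on the whole plane; summing
  only over the points in the allowed region restricts them to that region. The value is an
  extended nonnegative real since the sum is almost surely infinite for small path loss
  exponents.
\<close>

definition interference_component ::
    "params \<Rightarrow> scheme \<Rightarrow> nat set \<Rightarrow> link \<Rightarrow> real \<Rightarrow> link \<Rightarrow> interferer \<Rightarrow> 'w network \<Rightarrow> 'w \<Rightarrow> ennreal" where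
  "interference_component p sch S0 \<tau>0 r \<tau> x N \<omega> =
     (\<Sum>S\<in>site_classes. \<Sum>i.
        if enat i < npts N S \<omega> \<and> link_type N S i \<omega> = \<tau> \<and>
           allowed p \<tau>0 r S \<tau> (norm (pos N S i \<omega>)) \<and> pos N S i \<omega> \<notin> zone p sch \<tau> x
        then \<Sum>n\<in>S. received p N \<tau> (BS S i n) (norm (pos N S i \<omega>)) \<omega> else 0) +
     (if S0 = {1, 2} \<and> \<tau>0 = \<tau> \<and> \<not> in_zone p sch \<tau> x r
      then received p N \<tau> Colocated r \<omega> else 0)"

definition interference ::
    "params \<Rightarrow> scheme \<Rightarrow> nat set \<Rightarrow> link \<Rightarrow> real \<Rightarrow> (link \<Rightarrow> interferer \<Rightarrow> 'w network) \<Rightarrow> 'w \<Rightarrow> ennreal" where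
  "interference p sch S0 \<tau>0 r N \<omega> =
     interference_component p sch S0 \<tau>0 r LoS Hidden (N LoS Hidden) \<omega> +
     interference_component p sch S0 \<tau>0 r LoS Deaf (N LoS Deaf) \<omega> +
     interference_component p sch S0 \<tau>0 r NLoS Hidden (N NLoS Hidden) \<omega> +
     interference_component p sch S0 \<tau>0 r NLoS Deaf (N NLoS Deaf) \<omega>"

text \<open>
  \<open>M\<close> plays the role of the conditional law given that the serving site has class \<open>S0\<close>, link
  type \<open>\<tau>0\<close> and distance \<open>r\<close>. Each component is computed from its own realization
  \<open>N \<tau> x\<close> of the network: hidden and deaf interferers of one common realization would
  share sites, which is incompatible with the independence of the components.
\<close>

definition conditional_model ::
    "'w measure \<Rightarrow> params \<Rightarrow> scheme \<Rightarrow> nat set \<Rightarrow> link \<Rightarrow> real \<Rightarrow> (link \<Rightarrow> interferer \<Rightarrow> 'w network) \<Rightarrow> bool" where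
  "conditional_model M p sch S0 \<tau>0 r N \<longleftrightarrow>
     prob_space M \<and> (\<forall>\<tau> x. is_network M p (N \<tau> x)) \<and>
     prob_space.indep_vars M (\<lambda>_. borel)
       (\<lambda>(\<tau>, x). interference_component p sch S0 \<tau>0 r \<tau> x (N \<tau> x)) UNIV"

section \<open>Laplace transforms\<close>

text \<open>The map \<open>x \<mapsto> exp (-x)\<close> with the convention \<open>exp (-\<infinity>) = 0\<close>.\<close>

definition exp_neg :: "ennreal \<Rightarrow> real" where
  "exp_neg x = (if x = \<infinity> then 0 else exp (- enn2real x))"

definition laplace_transform :: "'w measure \<Rightarrow> ('w \<Rightarrow> ennreal) \<Rightarrow> real \<Rightarrow> real" where
  "laplace_transform M I s = (LINT \<omega>|M. exp_neg (ennreal s * I \<omega>))"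

definition tail_integral :: "real \<Rightarrow> (real \<Rightarrow> real) \<Rightarrow> ennreal" where
  "tail_integral b f = (\<integral>\<^sup>+t\<in>{b..}. ennreal (f t) \<partial>lborel)"

end

theory Submission
  imports Defs
begin

text \<open>
  Conditionally on the sites, the marks are independent, and a base station at distance \<open>t\<close>
  contributes the factor \<open>u(s,t)\<close> to the Laplace transform; a site of class \<open>S\<close> thus contributes
  \<open>u(s,t) ^ card S\<close>. Averaging over the link types replaces this by
  \<open>1 - p(t) (1 - u(s,t) ^ card S)\<close>, a function of the position alone, so the Laplace functional of
  the Poisson process applies. In polar coordinates the class \<open>{1, 2}\<close> enters with
  \<open>1 - u\<^sup>2 = (1 - u) (1 + u)\<close>, and together with class \<open>{1}\<close> this gives the factor
  \<open>(a - \<rho>) + \<rho> (1 + u) = a + \<rho> u\<close>. Infinite sums of interferers are handled by truncating to the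
  first \<open>m\<close> sites of each class.
\<close>

section \<open>The exponential of an extended nonnegative real\<close>

text \<open>The interference may be infinite and the tail integrals may diverge, so every identity
  is proved with values in \<open>ennreal\<close>, and only the last one is read back in the reals.
  \<open>exp_neg\<close> makes this uniform: it stays between 0 and 1, is continuous at infinity as
  well, and turns sums into products there too. Limits therefore pass under the expectation by
  bounded convergence, and a divergent exponent just gives 0. The order of integration is forced by
  the model: marks are independent of the sites as a whole, link types only given the positions.
  Both conditionings are done without conditional expectations: the identity map into a coarser
  sigma-algebra serves as the random variable that is frozen. Thinned Poisson processes are never
  formed. The Laplace functional of a Poisson process needs the exponential of a sum over sites,
  whereas averaging leaves a product. Taking logarithms requires strictly positive factors; they are
  positive because a station is silent (\<open>K = 0\<close>) with probability at least 1/2.\<close>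

lemma exp_neg_0 [simp]: "exp_neg 0 = 1"
  by (simp add: exp_neg_def)

lemma exp_neg_top [simp]: "exp_neg \<top> = 0"
  by (simp add: exp_neg_def)

lemma exp_neg_ennreal: "0 \<le> c \<Longrightarrow> exp_neg (ennreal c) = exp (- c)"
  by (simp add: exp_neg_def)

lemma exp_neg_nonneg [simp]: "0 \<le> exp_neg x"
  by (simp add: exp_neg_def)

lemma exp_neg_le_1 [simp]: "exp_neg x \<le> 1"
  by (simp add: exp_neg_def)

lemma exp_neg_add: "exp_neg (x + y) = exp_neg x * exp_neg y"
  by (cases x; cases y) (auto simp: exp_neg_def mult_exp_exp simp flip: ennreal_plus)

lemma exp_neg_sum: "exp_neg (sum f A) = (\<Prod>a\<in>A. exp_neg (f a))"
  by (induction A rule: infinite_finite_induct) (auto simp: exp_neg_add)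

lemma exp_neg_antimono: "x \<le> y \<Longrightarrow> exp_neg y \<le> exp_neg x"
  by (cases x; cases y) (auto simp: exp_neg_def top_unique)

lemma borel_measurable_exp_neg [measurable]: "exp_neg \<in> borel_measurable borel"
  unfolding exp_neg_def [abs_def] by measurable

text \<open>At a finite limit the terms are eventually finite and \<open>enn2real\<close> is
  continuous. At infinity \<open>enn2real\<close> is no help, so the convergence to 0 is checked
  directly from the decay of \<open>exp\<close>.\<close>

lemma tendsto_exp_neg:
  assumes "(f \<longlongrightarrow> L) A"
  shows "((\<lambda>i. exp_neg (f i)) \<longlongrightarrow> exp_neg L) A"
proof (cases L)
  case (real l)
  have "\<forall>\<^sub>F i in A. f i < \<top>"
    using assms real by (intro order_tendstoD(2)) auto
  then have *: "\<forall>\<^sub>F i in A. exp (- enn2real (f i)) = exp_neg (f i)"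
    by eventually_elim (auto simp: exp_neg_def)
  have "((\<lambda>i. exp (- enn2real (f i))) \<longlongrightarrow> exp (- l)) A"
    using assms real by (intro tendsto_intros) auto
  then show ?thesis
    using real by (auto simp: exp_neg_ennreal intro: Lim_transform_eventually[OF _ *])
next
  case top
  show ?thesis
  proof (rule tendstoI)
    fix e :: real assume e: "0 < e"
    \<comment> \<open>Chosen so that \<open>exp (- c) \<le> exp (ln e - 1) < e\<close>; the maximum
      with 0 keeps \<open>ennreal c\<close> from truncating.\<close>
    define c where "c = max 0 (1 - ln e)"
    have "\<forall>\<^sub>F i in A. ennreal c < f i"
      using assms top by (intro order_tendstoD(1)) auto
    then show "\<forall>\<^sub>F i in A. dist (exp_neg (f i)) (exp_neg L) < e"
    proof eventually_elim
      case (elim i)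
      have "exp_neg (f i) \<le> exp_neg (ennreal c)"
        using elim by (intro exp_neg_antimono) auto
      also have "\<dots> < exp (ln e)"
        unfolding exp_neg_ennreal[of c, unfolded c_def, simplified] c_def
        by (subst exp_neg_ennreal) auto
      finally show ?case using e top by simp
    qed
  qed
qed

text \<open>The constant 1 dominates and is integrable on a probability space, so neither
  monotonicity nor integrability of the \<open>f i\<close> is asked for.\<close>

lemma nn_integral_exp_neg_tendsto:
  assumes "prob_space M" "\<And>i. f i \<in> borel_measurable M" "g \<in> borel_measurable M"
    and "\<And>\<omega>. \<omega> \<in> space M \<Longrightarrow> (\<lambda>i. f i \<omega>) \<longlonglongrightarrow> g \<omega>"
  shows "(\<lambda>i. \<integral>\<^sup>+\<omega>. exp_neg (f i \<omega>) \<partial>M) \<longlonglongrightarrow> (\<integral>\<^sup>+\<omega>. exp_neg (g \<omega>) \<partial>M)"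
proof (rule nn_integral_dominated_convergence[where w = "\<lambda>_. 1"])
  show "(\<integral>\<^sup>+\<omega>. 1 \<partial>M) < \<infinity>"
    using assms(1) by (simp add: prob_space.emeasure_space_1)
  show "AE \<omega> in M. (\<lambda>i. ennreal (exp_neg (f i \<omega>))) \<longlonglongrightarrow> ennreal (exp_neg (g \<omega>))"
    using assms(4) by (auto intro!: tendsto_ennrealI tendsto_exp_neg)
qed (use assms in \<open>auto simp flip: ennreal_1 intro!: ennreal_leI\<close>)

section \<open>Radial integrals in the plane\<close>

text \<open>The disc of radius \<open>t\<close> has area \<open>pi * t\<^sup>2\<close>, whose
  derivative is the density. Half-lines form an intersection-stable generator, so equality on them
  suffices; \<open>max 0 t\<close> covers negative \<open>t\<close>, where the preimage is
  empty.\<close>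

lemma distr_norm_lborel:
  "distr lborel borel (norm :: real^2 \<Rightarrow> real)
     = density lborel (\<lambda>t. ennreal (2 * pi * t) * indicator {0..} t)" (is "?M = ?N")
proof (rule measure_eqI_generator_eq[where E = "range atMost" and \<Omega> = UNIV and A = "\<lambda>n. {..real n}"])
  have sb: "sets borel = sigma_sets UNIV (range (atMost :: real \<Rightarrow> real set))"
    by (subst borel_eq_atMost) (auto simp: sets_measure_of_conv)
  show "sets ?M = sigma_sets UNIV (range atMost)" "sets ?N = sigma_sets UNIV (range atMost)"
    using sb by auto
  have M: "emeasure ?M {..t} = ennreal (pi * (max 0 t)\<^sup>2)" for t
  proof -
    have "norm -` {..t} = (if t < 0 then {} else cball 0 t :: (real^2) set)"
      by (auto simp: not_less dest: order.trans[OF norm_ge_zero])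
    then have "emeasure ?M {..t} = emeasure lborel (if t < 0 then {} else cball 0 t :: (real^2) set)"
      by (subst emeasure_distr) auto
    also have "\<dots> = ennreal (pi * (max 0 t)\<^sup>2)"
      using emeasure_cball[of t "0 :: real^2"] by (auto simp: unit_ball_vol_2)
    finally show ?thesis .
  qed
  have N: "emeasure ?N {..t} = ennreal (pi * (max 0 t)\<^sup>2)" for t
  proof -
    have "emeasure ?N {..t} = (\<integral>\<^sup>+x. ennreal (2 * pi * x) * indicator {0..} x * indicator {..t} x \<partial>lborel)"
      by (subst emeasure_density) auto
    also have "\<dots> = (\<integral>\<^sup>+x. ennreal (2 * pi * x) * indicator {0..max 0 t} x \<partial>lborel)"
      by (intro nn_integral_cong) (auto split: split_indicator)
    also have "\<dots> = ennreal (pi * (max 0 t)\<^sup>2 - pi * 0\<^sup>2)"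
      by (intro nn_integral_FTC_Icc) (auto intro!: derivative_eq_intros)
    finally show ?thesis by simp
  qed
  show "emeasure ?M X = emeasure ?N X" if "X \<in> range atMost" for X
    using that M N by force
  show "emeasure ?M {..real n} \<noteq> \<infinity>" for n
    using M by auto
  show "(\<Union>n. {..real n}) = UNIV"
    using real_arch_simple by auto
  show "Int_stable (range atMost :: real set set)"
    by (auto simp: Int_stable_def)
qed auto

lemma nn_integral_radial:
  assumes [measurable]: "f \<in> borel_measurable borel"
  shows "(\<integral>\<^sup>+(x::real^2). f (norm x) \<partial>lborel) = 2 * pi * (\<integral>\<^sup>+t\<in>{0..}. (f t * ennreal t) \<partial>lborel)"
proof -
  have "(\<integral>\<^sup>+(x::real^2). f (norm x) \<partial>lborel) = (\<integral>\<^sup>+t. f t \<partial>distr lborel borel (norm :: real^2 \<Rightarrow> real))"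
    by (subst nn_integral_distr) auto
  also have "\<dots> = (\<integral>\<^sup>+t. ennreal (2 * pi) * (f t * ennreal t * indicator {0..} t) \<partial>lborel)"
    unfolding distr_norm_lborel
    by (subst nn_integral_density)
       (auto intro!: nn_integral_cong simp: ennreal_mult mult_ac split: split_indicator)
  also have "\<dots> = 2 * pi * (\<integral>\<^sup>+t\<in>{0..}. (f t * ennreal t) \<partial>lborel)"
    by (subst nn_integral_cmult) auto
  finally show ?thesis .
qed

section \<open>The Laplace functional of a Poisson process\<close>

lemma point_count_eq_suminf:
  "point_count n X B \<omega> = (\<Sum>i. if enat i < n \<omega> then indicator B (X i \<omega>) else 0)"
proof -
  have "point_count n X B \<omega> = (\<integral>\<^sup>+i. indicator {i. enat i < n \<omega> \<and> X i \<omega> \<in> B} i \<partial>count_space UNIV)"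
    by (simp add: point_count_def)
  also have "\<dots> = (\<Sum>i. if enat i < n \<omega> then indicator B (X i \<omega>) else 0)"
    by (subst nn_integral_count_space_nat) (auto intro!: suminf_cong split: split_indicator)
  finally show ?thesis .
qed

text \<open>This is the generating function of the Poisson law at \<open>exp (- c)\<close>: the
  factor \<open>exp (- c * k)\<close> is absorbed into \<open>\<mu> ^ k\<close>, and the exponential
  series is summed.\<close>

lemma (in prob_space) nn_integral_exp_neg_Poisson:
  assumes Y [measurable]: "Y \<in> borel_measurable M" and "0 \<le> \<mu>" "0 \<le> c"
    and Poisson: "\<And>k. prob {\<omega>\<in>space M. Y \<omega> = of_nat k} = \<mu> ^ k / fact k * exp (- \<mu>)"
  shows "(\<integral>\<^sup>+\<omega>. exp_neg (ennreal c * Y \<omega>) \<partial>M) = ennreal (exp (- (\<mu> * (1 - exp (- c)))))"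
proof -
  define A where "A k = {\<omega>\<in>space M. Y \<omega> = of_nat k}" for k
  have [measurable]: "A k \<in> sets M" for k
    unfolding A_def by measurable
  have exp_sums: "(\<lambda>k. x ^ k / fact k) sums exp x" for x :: real
    using exp_converges[of x] by (simp add: divide_inverse_commute)
  have "disjoint_family A"
    by (auto simp: disjoint_family_on_def A_def)
  then have "(\<lambda>k. prob (A k)) sums prob (\<Union>k. A k)"
    by (intro finite_measure_UNION) auto
  moreover have "(\<lambda>k. prob (A k)) sums (exp \<mu> * exp (- \<mu>))"
    unfolding A_def Poisson by (intro sums_mult2 exp_sums)
  \<comment> \<open>Only the masses at natural numbers are given. Since they add up to 1, the value
    infinity and all non-integral values have probability 0.\<close>
  ultimately have "prob (\<Union>k. A k) = 1"
    by (simp add: sums_iff exp_minus_inverse)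
  then have AE: "AE \<omega> in M. \<omega> \<in> (\<Union>k. A k)"
    by (rule AE_prob_1)
  have "(\<integral>\<^sup>+\<omega>. exp_neg (ennreal c * Y \<omega>) \<partial>M)
      = (\<integral>\<^sup>+\<omega>. (\<Sum>k. ennreal (exp (- c * k)) * indicator (A k) \<omega>) \<partial>M)"
  proof (rule nn_integral_cong_AE, use AE in eventually_elim)
    case (elim \<omega>)
    then obtain k where k: "\<omega> \<in> A k" by auto
    have "(\<Sum>j. ennreal (exp (- c * j)) * indicator (A j) \<omega>)
        = (\<Sum>j. if j = k then ennreal (exp (- c * j)) else 0)"
      using k by (intro suminf_cong) (auto simp: A_def)
    also have "\<dots> = ennreal (exp (- c * k))"
      by (rule sums_unique[symmetric, OF sums_single])
    finally show ?case
      using k \<open>0 \<le> c\<close> by (simp add: A_def exp_neg_ennreal flip: ennreal_of_nat_eq_real_of_nat ennreal_mult)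
       (simp add: ennreal_of_nat_eq_real_of_nat exp_neg_ennreal flip: ennreal_mult)
  qed
  also have "\<dots> = (\<Sum>k. ennreal (exp (- c * k)) * emeasure M (A k))"
    by (subst nn_integral_suminf) (auto simp: nn_integral_cmult)
  also have "\<dots> = (\<Sum>k. ennreal ((\<mu> * exp (- c)) ^ k / fact k * exp (- \<mu>)))"
    using \<open>0 \<le> \<mu>\<close>
    by (intro suminf_cong)
       (simp add: emeasure_eq_measure A_def Poisson power_mult_distrib mult_ac
          exp_of_nat_mult[symmetric] flip: ennreal_mult)
  also have "\<dots> = ennreal (exp (\<mu> * exp (- c)) * exp (- \<mu>))"
    using \<open>0 \<le> \<mu>\<close> exp_sums
    by (intro suminf_ennreal_eq sums_mult2) auto
  also have "exp (\<mu> * exp (- c)) * exp (- \<mu>) = exp (- (\<mu> * (1 - exp (- c))))"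
    by (simp add: algebra_simps flip: exp_add)
  finally show ?thesis .
qed

text \<open>The case of a step function with disjoint bounded level sets \<open>B k\<close>: the
  counts are independent, so the transform is a product of Poisson transforms. Boundedness makes the
  Lebesgue measures finite, so \<open>measure\<close> and \<open>emeasure\<close> agree.\<close>

lemma (in prob_space) PPP_laplace_simple:
  fixes m :: nat
  assumes PPP: "homogeneous_PPP M d n X" and "0 \<le> d"
    and B: "\<And>k. k < m \<Longrightarrow> B k \<in> sets borel" "\<And>k. k < m \<Longrightarrow> bounded (B k)"
      "disjoint_family_on B {..<m}"
    and c: "\<And>k. k < m \<Longrightarrow> 0 \<le> c k"
  shows "(\<integral>\<^sup>+\<omega>. exp_neg (\<Sum>k<m. ennreal (c k) * point_count n X (B k) \<omega>) \<partial>M)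
    = exp_neg (ennreal d * (\<Sum>k<m. ennreal (1 - exp (- c k)) * emeasure lborel (B k)))"
proof -
  have *: "\<forall>B (m::nat). (\<forall>i<m. B i \<in> sets borel \<and> bounded (B i)) \<longrightarrow>
      disjoint_family_on B {..<m} \<longrightarrow> indep_vars (\<lambda>_. borel) (\<lambda>i. point_count n X (B i)) {..<m}"
    using PPP unfolding homogeneous_PPP_def by (elim conjE)
  have ind: "indep_vars (\<lambda>_. borel) (\<lambda>k. point_count n X (B k)) {..<m}"
    by (rule *[rule_format]) (use B in auto)
  have [measurable]: "k < m \<Longrightarrow> point_count n X (B k) \<in> borel_measurable M" for k
    using ind by (auto simp: indep_vars_def2)
  have "(\<integral>\<^sup>+\<omega>. exp_neg (\<Sum>k<m. ennreal (c k) * point_count n X (B k) \<omega>) \<partial>M)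
      = (\<integral>\<^sup>+\<omega>. (\<Prod>k<m. ennreal (exp_neg (ennreal (c k) * point_count n X (B k) \<omega>))) \<partial>M)"
    by (simp add: exp_neg_sum prod_ennreal)
  also have "\<dots> = (\<Prod>k<m. \<integral>\<^sup>+\<omega>. ennreal (exp_neg (ennreal (c k) * point_count n X (B k) \<omega>)) \<partial>M)"
    by (intro indep_vars_nn_integral indep_vars_compose2[OF ind, where Y = "\<lambda>k x. ennreal (exp_neg (ennreal (c k) * x))"]) auto
  also have "\<dots> = (\<Prod>k<m. ennreal (exp (- (d * measure lborel (B k) * (1 - exp (- c k))))))"
    using PPP B c \<open>0 \<le> d\<close>
    by (intro prod.cong refl nn_integral_exp_neg_Poisson) (auto simp: homogeneous_PPP_def)
  also have "\<dots> = (\<Prod>k<m. ennreal (exp_neg (ennreal d * (ennreal (1 - exp (- c k)) * emeasure lborel (B k)))))"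
  proof (intro prod.cong refl arg_cong[where f = ennreal])
    fix k assume "k \<in> {..<m}"
    then have k: "emeasure lborel (B k) = ennreal (measure lborel (B k))" "0 \<le> c k"
      using B(1,2)[of k] c emeasure_bounded_finite[of "B k"] by (auto simp: emeasure_eq_ennreal_measure)
    show "exp (- (d * measure lborel (B k) * (1 - exp (- c k))))
        = exp_neg (ennreal d * (ennreal (1 - exp (- c k)) * emeasure lborel (B k)))"
      using k \<open>0 \<le> d\<close> by (simp add: exp_neg_ennreal mult_ac flip: ennreal_mult)
  qed
  also have "\<dots> = ennreal (exp_neg (ennreal d * (\<Sum>k<m. ennreal (1 - exp (- c k)) * emeasure lborel (B k))))"
    by (simp add: exp_neg_sum prod_ennreal sum_distrib_left)
  finally show ?thesis .
qed

text \<open>Both sides are continuous along an increasing sequence of step functions: the left one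
  by bounded convergence, the right one by monotone convergence of the exponent. Infinite values of
  \<open>f\<close> and an infinite exponent are included.\<close>

theorem (in prob_space) PPP_laplace:
  assumes PPP: "homogeneous_PPP M d n X" and "0 \<le> d" and f: "f \<in> borel_measurable borel"
  shows "(\<integral>\<^sup>+\<omega>. exp_neg (\<Sum>i. if enat i < n \<omega> then f (X i \<omega>) else 0) \<partial>M)
    = exp_neg (ennreal d * (\<integral>\<^sup>+x. ennreal (1 - exp_neg (f x)) \<partial>lborel))"
proof -
  have [measurable]: "n \<in> measurable M (count_space UNIV)" "X i \<in> borel_measurable M" for i
    using PPP by (auto simp: homogeneous_PPP_def)
  note [measurable] = f
  obtain U where U: "\<And>i. simple_function borel (U i)" "incseq U" "\<And>i x. U i x < \<top>"
      "\<And>x. (SUP i. U i x) = f x"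
    using borel_measurable_implies_simple_function_sequence'[OF f] by blast
  \<comment> \<open>The count of a set is only known to be Poisson for bounded sets, so the
    approximation is cut off by a ball that grows with \<open>j\<close>; it still increases to
    \<open>f\<close>.\<close>
  define V where "V j x = U j x * indicator (ball 0 (real j)) x" for j x
  have V: "simple_function borel (V j)" for j
    unfolding V_def by (intro simple_function_mult simple_function_indicator U) auto
  have [measurable]: "V j \<in> borel_measurable borel" for j
    using V by (rule borel_measurable_simple_function)
  have V_mono: "V j x \<le> V k x" if "j \<le> k" for j k x
    using that le_funD[OF incseqD[OF U(2) that], of x]
    by (auto simp: V_def split: split_indicator)
  have V_lim: "(\<lambda>j. V j x) \<longlonglongrightarrow> f x" for x
  proof -
    have "(\<lambda>j. U j x) \<longlonglongrightarrow> f x"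
      using U(2) LIMSEQ_SUP[of "\<lambda>j. U j x"] by (simp add: U(4) incseq_def le_fun_def)
    moreover have "\<forall>\<^sub>F j in sequentially. U j x = V j x"
      using eventually_gt_at_top[of "nat \<lceil>norm x\<rceil>"]
      by eventually_elim (auto simp: V_def split: split_indicator, linarith)
    ultimately show ?thesis
      by (rule Lim_transform_eventually)
  qed
  define S where "S g \<omega> = (\<Sum>i. if enat i < n \<omega> then g (X i \<omega>) else 0)" for g :: "real^2 \<Rightarrow> ennreal" and \<omega>
  have [measurable]: "S g \<in> borel_measurable M" if [measurable]: "g \<in> borel_measurable borel" for g
    unfolding S_def by measurable
  have step: "(\<integral>\<^sup>+\<omega>. exp_neg (S (V j) \<omega>) \<partial>M)
      = exp_neg (ennreal d * (\<integral>\<^sup>+x. ennreal (1 - exp_neg (V j x)) \<partial>lborel))" for j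
  proof -
    \<comment> \<open>The value 0 is left out because its level set is unbounded.\<close>
    define R where "R = V j ` UNIV - {0}"
    have "finite R"
      using V[of j] by (auto simp: simple_function_def R_def)
    then obtain e where e: "bij_betw e {..<card R} R"
      using ex_bij_betw_nat_finite lessThan_atLeast0 by metis
    define B where "B k = V j -` {e k}" for k
    have eR: "e k \<in> R" if "k < card R" for k
      using e that by (auto simp: bij_betw_def)
    have fin: "e k = ennreal (enn2real (e k))" if "k < card R" for k
      using eR[OF that] U(3) by (auto simp: R_def V_def less_top ennreal_mult_eq_top_iff split: split_indicator)
    have B_meas: "B k \<in> sets borel" for k
      unfolding B_def by (auto intro!: measurable_sets_borel[of "V j" borel])
    have B_bdd: "bounded (B k)" if "k < card R" for k
    proof (rule bounded_subset[of "ball 0 (real j)"])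
      show "B k \<subseteq> ball 0 (real j)"
      proof
        fix x assume "x \<in> B k"
        then have "V j x \<noteq> 0"
          using eR[OF that] by (auto simp: B_def R_def)
        then show "x \<in> ball 0 (real j)"
          by (auto simp: V_def split: split_indicator_asm)
      qed
    qed auto
    have B_disj: "disjoint_family_on B {..<card R}"
      using e by (auto simp: disjoint_family_on_def B_def bij_betw_def inj_on_def)
    \<comment> \<open>Stated for any \<open>g\<close> vanishing at 0 because it is used twice: with
      the identity to express the sum over points by counts, and with \<open>1 - exp_neg\<close> to
      evaluate the integral in the exponent.\<close>
    have V_sum: "g (V j x) = (\<Sum>k<card R. g (e k) * indicator (B k) x)" if "g 0 = 0" for g :: "ennreal \<Rightarrow> ennreal" and x
    proof -
      have "(\<Sum>k<card R. g (e k) * indicator (B k) x) = (\<Sum>y\<in>R. g y * indicator (V j -` {y}) x)"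
        unfolding B_def by (rule sum.reindex_bij_betw[OF e])
      also have "\<dots> = (\<Sum>y\<in>R. if y = V j x then g y else 0)"
        by (intro sum.cong) (auto split: split_indicator)
      also have "\<dots> = g (V j x)"
        using that \<open>finite R\<close> by (auto simp: R_def)
      finally show ?thesis ..
    qed
    have "S (V j) \<omega> = (\<Sum>k<card R. ennreal (enn2real (e k)) * point_count n X (B k) \<omega>)" for \<omega>
    proof -
      have "S (V j) \<omega> = (\<Sum>i. \<Sum>k<card R. e k * (if enat i < n \<omega> then indicator (B k) (X i \<omega>) else 0))"
        unfolding S_def using V_sum[of "\<lambda>x. x"] by (intro suminf_cong) auto
      also have "\<dots> = (\<Sum>k<card R. \<Sum>i. e k * (if enat i < n \<omega> then indicator (B k) (X i \<omega>) else 0))"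
        by (rule suminf_sum) auto
      also have "\<dots> = (\<Sum>k<card R. ennreal (enn2real (e k)) * point_count n X (B k) \<omega>)"
        unfolding point_count_eq_suminf
        by (intro sum.cong refl) (use fin in \<open>auto simp: ennreal_suminf_cmult\<close>)
      finally show ?thesis .
    qed
    then have "(\<integral>\<^sup>+\<omega>. exp_neg (S (V j) \<omega>) \<partial>M)
        = exp_neg (ennreal d * (\<Sum>k<card R. ennreal (1 - exp (- enn2real (e k))) * emeasure lborel (B k)))"
      using PPP_laplace_simple[OF PPP \<open>0 \<le> d\<close>, where m = "card R" and B = B and c = "\<lambda>k. enn2real (e k)"] B_meas B_bdd B_disj
      by simp
    also have "(\<Sum>k<card R. ennreal (1 - exp (- enn2real (e k))) * emeasure lborel (B k))
        = (\<Sum>k<card R. ennreal (1 - exp_neg (e k)) * emeasure lborel (B k))"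
    proof (intro sum.cong refl)
      fix k assume "k \<in> {..<card R}"
      then have "exp_neg (e k) = exp (- enn2real (e k))"
        using exp_neg_ennreal[of "enn2real (e k)"] fin[of k] by simp
      then show "ennreal (1 - exp (- enn2real (e k))) * emeasure lborel (B k)
          = ennreal (1 - exp_neg (e k)) * emeasure lborel (B k)" by simp
    qed
    also have "\<dots> = (\<integral>\<^sup>+x. ennreal (1 - exp_neg (V j x)) \<partial>lborel)"
      unfolding V_sum[of "\<lambda>y. ennreal (1 - exp_neg y)", simplified exp_neg_0 diff_self ennreal_0, OF refl]
      by (subst nn_integral_sum) (use B_meas in \<open>auto simp: nn_integral_cmult\<close>)
    finally show ?thesis .
  qed
  \<comment> \<open>The series is read as an integral against counting measure, so that monotone
    convergence exchanges it with the limit in \<open>j\<close>.\<close>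
  have S_lim: "(\<lambda>j. S (V j) \<omega>) \<longlonglongrightarrow> S f \<omega>" for \<omega>
  proof -
    have "(\<lambda>j. \<integral>\<^sup>+i. (if enat i < n \<omega> then V j (X i \<omega>) else 0) \<partial>count_space UNIV)
        \<longlonglongrightarrow> (\<integral>\<^sup>+i. (if enat i < n \<omega> then f (X i \<omega>) else 0) \<partial>count_space UNIV)"
      by (rule nn_integral_LIMSEQ) (auto intro: V_mono V_lim simp: incseq_def le_fun_def)
    then show ?thesis
      by (simp add: S_def nn_integral_count_space_nat)
  qed
  have "(\<lambda>j. \<integral>\<^sup>+\<omega>. exp_neg (S (V j) \<omega>) \<partial>M) \<longlonglongrightarrow> (\<integral>\<^sup>+\<omega>. exp_neg (S f \<omega>) \<partial>M)"
    using S_lim by (intro nn_integral_exp_neg_tendsto) (auto intro: prob_space_axioms)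
  moreover have "(\<lambda>j. \<integral>\<^sup>+x. ennreal (1 - exp_neg (V j x)) \<partial>lborel)
      \<longlonglongrightarrow> (\<integral>\<^sup>+x. ennreal (1 - exp_neg (f x)) \<partial>lborel)"
    by (rule nn_integral_LIMSEQ)
       (auto simp: incseq_def le_fun_def intro!: ennreal_leI exp_neg_antimono V_mono tendsto_ennrealI tendsto_diff tendsto_exp_neg V_lim)
  then have "(\<lambda>j. ennreal (exp_neg (ennreal d * (\<integral>\<^sup>+x. ennreal (1 - exp_neg (V j x)) \<partial>lborel))))
      \<longlonglongrightarrow> ennreal (exp_neg (ennreal d * (\<integral>\<^sup>+x. ennreal (1 - exp_neg (f x)) \<partial>lborel)))"
    by (intro tendsto_ennrealI tendsto_exp_neg ennreal_tendsto_cmult) auto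
  ultimately show ?thesis
    unfolding step using LIMSEQ_unique unfolding S_def by blast
qed

section \<open>Integration of the marks\<close>

text \<open>The product rule on rectangles identifies the joint law with a product measure, and
  Fubini lets \<open>X\<close> be frozen. In this form the lemma also applies when \<open>X\<close>
  is the identity map into a smaller sigma-algebra, which replaces conditioning on the
  sites.\<close>

lemma (in prob_space) nn_integral_independent:
  assumes rv [measurable]: "random_variable S X" "random_variable T Y"
    and ind: "\<And>A B. A \<in> sets S \<Longrightarrow> B \<in> sets T \<Longrightarrow>
      prob ((\<lambda>\<omega>. (X \<omega>, Y \<omega>)) -` (A \<times> B) \<inter> space M) = prob (X -` A \<inter> space M) * prob (Y -` B \<inter> space M)"
    and g: "(\<lambda>(x, y). g x y) \<in> borel_measurable (S \<Otimes>\<^sub>M T)"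
  shows "(\<integral>\<^sup>+\<omega>. g (X \<omega>) (Y \<omega>) \<partial>M) = (\<integral>\<^sup>+\<omega>. (\<integral>\<^sup>+\<omega>'. g (X \<omega>) (Y \<omega>') \<partial>M) \<partial>M)"
proof -
  note [measurable] = g
  interpret X: prob_space "distr M S X"
    by (rule prob_space_distr) simp
  interpret Y: prob_space "distr M T Y"
    by (rule prob_space_distr) simp
  have eq: "distr M S X \<Otimes>\<^sub>M distr M T Y = distr M (S \<Otimes>\<^sub>M T) (\<lambda>\<omega>. (X \<omega>, Y \<omega>))"
  proof (rule pair_measure_eqI)
    fix A B assume "A \<in> sets (distr M S X)" "B \<in> sets (distr M T Y)"
    then show "emeasure (distr M S X) A * emeasure (distr M T Y) B
        = emeasure (distr M (S \<Otimes>\<^sub>M T) (\<lambda>\<omega>. (X \<omega>, Y \<omega>))) (A \<times> B)"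
      using ind[of A B] by (simp add: emeasure_distr emeasure_eq_measure ennreal_mult'')
  qed (auto intro: X.sigma_finite_measure_axioms Y.sigma_finite_measure_axioms
      simp: sets_pair_measure_cong[OF sets_distr sets_distr])
  have "(\<integral>\<^sup>+\<omega>. g (X \<omega>) (Y \<omega>) \<partial>M) = (\<integral>\<^sup>+z. (\<lambda>(x, y). g x y) z \<partial>distr M (S \<Otimes>\<^sub>M T) (\<lambda>x. (X x, Y x)))"
    by (subst nn_integral_distr) auto
  also have "\<dots> = (\<integral>\<^sup>+x. (\<integral>\<^sup>+y. g x y \<partial>distr M T Y) \<partial>distr M S X)"
    unfolding eq[symmetric]
    by (subst Y.nn_integral_fst[symmetric]) (auto simp: measurable_cong_sets[OF sets_pair_measure_cong[OF sets_distr sets_distr] refl])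
  also have "\<dots> = (\<integral>\<^sup>+\<omega>. (\<integral>\<^sup>+y. g (X \<omega>) y \<partial>distr M T Y) \<partial>M)"
    by (subst nn_integral_distr) auto
  also have "\<dots> = (\<integral>\<^sup>+\<omega>. (\<integral>\<^sup>+\<omega>'. g (X \<omega>) (Y \<omega>') \<partial>M) \<partial>M)"
    using measurable_space[OF \<open>random_variable S X\<close>]
    by (intro nn_integral_cong, subst nn_integral_distr) auto
  finally show ?thesis .
qed

lemma (in prob_space) indep_var_nn_integral:
  assumes ind: "indep_var S X T Y" and g: "(\<lambda>(x, y). g x y) \<in> borel_measurable (S \<Otimes>\<^sub>M T)"
  shows "(\<integral>\<^sup>+\<omega>. g (X \<omega>) (Y \<omega>) \<partial>M) = (\<integral>\<^sup>+\<omega>. (\<integral>\<^sup>+\<omega>'. g (X \<omega>) (Y \<omega>') \<partial>M) \<partial>M)"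
  by (rule nn_integral_independent[OF indep_var_rv1[OF ind] indep_var_rv2[OF ind] indep_varD[OF ind] g])

lemma (in prob_space) indep_var_commute: "indep_var S X T Y \<Longrightarrow> indep_var T Y S X"
  unfolding indep_var_eq indep_sets2_eq
  by (elim conjE, intro conjI ballI, assumption+, subst Int_commute, subst mult.commute, blast)

text \<open>The list may contain one value several times, as happens when two antenna gains
  coincide. The mass of a value is then the sum over its entries, and the double sum has to be
  regrouped.\<close>

lemma nn_integral_pmf_of_list:
  fixes xs :: "('a \<times> real) list"
  assumes "pmf_of_list_wf xs"
  shows "(\<integral>\<^sup>+x. f x \<partial>measure_pmf (pmf_of_list xs)) = (\<Sum>(x, q)\<leftarrow>xs. ennreal q * f x)"
proof -
  let ?A = "fst ` set xs"
  have nonneg: "0 \<le> q" if "(x, q) \<in> set xs" for x q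
    using assms that by (force simp: pmf_of_list_wf_def)
  have "(\<integral>\<^sup>+x. f x \<partial>measure_pmf (pmf_of_list xs)) = (\<Sum>x\<in>?A. f x * ennreal (pmf (pmf_of_list xs) x))"
    using set_pmf_of_list[OF assms]
    by (intro nn_integral_measure_pmf_support) (auto simp: image_iff)
  also have "\<dots> = (\<Sum>x\<in>?A. f x * (\<Sum>(y, q)\<leftarrow>xs. if y = x then ennreal q else 0))"
  proof (intro sum.cong refl arg_cong2[where f = "(*)"])
    fix x :: 'a
    have "ennreal (sum_list (map snd (filter (\<lambda>z. fst z = x) ys))) = (\<Sum>(y, q)\<leftarrow>ys. if y = x then ennreal q else 0)"
      if "\<And>y q. (y, q) \<in> set ys \<Longrightarrow> 0 \<le> q" for ys
      using that
    proof (induction ys)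
      case (Cons z ys)
      show ?case
      proof (cases z)
        case (Pair y q)
        have "0 \<le> sum_list (map snd (filter (\<lambda>z. fst z = x) ys))"
          using Cons.prems by (intro sum_list_nonneg) force
        moreover have "0 \<le> q"
          using Cons.prems Pair by auto
        ultimately show ?thesis
          using Cons.IH Cons.prems by (auto simp: Pair)
      qed
    qed auto
    then show "ennreal (pmf (pmf_of_list xs) x) = (\<Sum>(y, q)\<leftarrow>xs. if y = x then ennreal q else 0)"
      using nonneg by (simp add: pmf_pmf_of_list[OF assms])
  qed
  also have "\<dots> = (\<Sum>(y, q)\<leftarrow>xs. ennreal q * f y)"
  proof -
    \<comment> \<open>Generalized to any finite set \<open>B\<close> containing the values, so that
      the index set stays fixed during the induction on the list.\<close>
    have "(\<Sum>x\<in>B. f x * (\<Sum>(y, q)\<leftarrow>ys. if y = x then ennreal q else 0)) = (\<Sum>(y, q)\<leftarrow>ys. ennreal q * f y)"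
      if "finite B" "fst ` set ys \<subseteq> B" for B ys
      using that(2)
    proof (induction ys)
      case (Cons z ys)
      obtain y q where z: "z = (y, q)" by (cases z)
      have "(\<Sum>x\<in>B. f x * (if y = x then ennreal q else 0)) = (\<Sum>x\<in>B. if x = y then ennreal q * f x else 0)"
        by (intro sum.cong) (auto simp: mult.commute)
      also have "\<dots> = ennreal q * f y"
        using Cons.prems \<open>finite B\<close> z by auto
      finally show ?case
        using Cons by (simp add: z distrib_left sum.distrib)
    qed simp
    then show ?thesis by simp
  qed
  finally show ?thesis .
qed

text \<open>Multiplying the density of rate 1 by \<open>exp (- c * x)\<close> gives
  \<open>1 / (1 + c)\<close> times the density of rate \<open>1 + c\<close>, whose total mass is
  1.\<close>

lemma nn_integral_exponential_exp_neg:
  assumes "0 \<le> c"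
  shows "(\<integral>\<^sup>+x. ennreal (exponential_density 1 x) * exp_neg (ennreal (c * x)) \<partial>lborel) = ennreal (1 / (1 + c))"
proof -
  have "(\<integral>\<^sup>+x. ennreal (exponential_density 1 x) * exp_neg (ennreal (c * x)) \<partial>lborel)
      = (\<integral>\<^sup>+x. ennreal (1 / (1 + c)) * ennreal (exponential_density (1 + c) x) \<partial>lborel)"
  proof (intro nn_integral_cong)
    fix x :: real
    have "exp (- x) * exp (- (c * x)) = exp (- x * (1 + c))"
      using assms by (simp add: mult_exp_exp algebra_simps)
    then show "ennreal (exponential_density 1 x) * exp_neg (ennreal (c * x))
        = ennreal (1 / (1 + c)) * ennreal (exponential_density (1 + c) x)"
      using assms by (auto simp: exponential_density_def exp_neg_ennreal simp flip: ennreal_mult)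
  qed
  also have "\<dots> = ennreal (1 / (1 + c)) * emeasure (density lborel (exponential_density (1 + c))) UNIV"
    by (subst nn_integral_cmult) (auto simp: emeasure_density)
  also have "emeasure (density lborel (exponential_density (1 + c))) UNIV = 1"
    using prob_space.emeasure_space_1[OF prob_space_exponential_density[of "1 + c"]] assms by simp
  finally show ?thesis by simp
qed

section \<open>Laws of the marks and the transform of a single station\<close>

lemma site_classes_finite [simp]: "finite site_classes"
  by (simp add: site_classes_def)

lemma site_class_finite [simp]: "S \<in> site_classes \<Longrightarrow> finite S"
  by (auto simp: site_classes_def)

lemma beam_fractions:
  assumes "valid_params p"
  shows "\<theta>_BS p / (2 * pi) \<in> {0..1}" "\<theta>_UE p / (2 * pi) \<in> {0..1}"
  using assms by (auto simp: valid_params_def)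

lemma gain_dist_pos: "valid_params p \<Longrightarrow> (g, q) \<in> set (gain_dist p) \<Longrightarrow> 0 < g \<and> 0 \<le> q"
  using beam_fractions[of p] by (auto simp: valid_params_def gain_dist_def Let_def)

lemma gain_dist_sum: "(\<Sum>(g, q)\<leftarrow>gain_dist p. q) = 1"
  by (simp add: gain_dist_def Let_def algebra_simps)

lemma gain_dist_wf: "valid_params p \<Longrightarrow> pmf_of_list_wf (gain_dist p)"
  using gain_dist_pos[of p] gain_dist_sum[of p]
  by (auto simp: pmf_of_list_wf_def case_prod_unfold)

lemma transmit_dist_wf: "valid_params p \<Longrightarrow> pmf_of_list_wf (transmit_dist p)"
  by (auto simp: pmf_of_list_wf_def valid_params_def transmit_dist_def)

text \<open>Gathers the three kinds of marks into one real-valued family indexed by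
  \<open>source\<close>, the form in which \<open>indep_vars\<close> and its grouping lemmas
  apply.\<close>

definition mark :: "'w network \<Rightarrow> source \<Rightarrow> 'w \<Rightarrow> real" where
  "mark N b = (case b of K_mark b \<Rightarrow> K N b | F_mark b \<Rightarrow> F N b | G_mark b \<Rightarrow> G N b | Sites \<Rightarrow> \<lambda>_. 0)"

definition fading :: "'w network \<Rightarrow> station \<Rightarrow> 'w \<Rightarrow> real" where
  "fading N b \<omega> = K N b \<omega> * F N b \<omega> * G N b \<omega>"

definition marks :: "station set \<Rightarrow> source set" where
  "marks A = K_mark ` A \<union> F_mark ` A \<union> G_mark ` A"

lemma source_events_mark:
  "b \<noteq> Sites \<Longrightarrow> source_events M N b = {mark N b -` X \<inter> space M | X. X \<in> sets borel}"
  by (cases b) (simp_all add: mark_def)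

text \<open>Describes one realization of the network. It is interpreted separately for each of the
  four interference components, which live on the same space \<open>M\<close>.\<close>

locale network_model = prob_space M
  for M :: "'w measure" and p :: params and N :: "'w network" +
  assumes params: "valid_params p" and network: "is_network M p N"
begin

lemma indep_sources: "indep_sets (source_events M N) (insert Sites (marks stations))"
proof -
  have "insert Sites (marks stations) = {Sites} \<union> K_mark ` stations \<union> F_mark ` stations \<union> G_mark ` stations"
    by (auto simp: marks_def)
  then show ?thesis using network by (simp add: is_network_def)
qed

lemma marks_measurable [measurable]:
  assumes "b \<in> stations"
  shows "K N b \<in> borel_measurable M" "F N b \<in> borel_measurable M" "G N b \<in> borel_measurable M"
  using network assms by (auto simp: is_network_def distributed_def)

lemma mark_measurable: "b \<in> marks stations \<Longrightarrow> mark N b \<in> borel_measurable M"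
  by (auto simp: marks_def mark_def marks_measurable)

lemma indep_marks: "indep_vars (\<lambda>_. borel) (mark N) (marks stations)"
  unfolding indep_vars_def2
proof
  have "indep_sets (source_events M N) (marks stations)"
    using indep_sources by (rule indep_sets_mono_index[rotated]) auto
  then show "indep_sets (\<lambda>i. {mark N i -` A \<inter> space M |A. A \<in> sets borel}) (marks stations)"
    by (rule indep_sets_cong[THEN iffD1, rotated -1]) (rule refl, rule source_events_mark, auto simp: marks_def)
qed (auto intro: mark_measurable)

lemma fading_measurable [measurable]: "b \<in> stations \<Longrightarrow> fading N b \<in> borel_measurable M"
  unfolding fading_def [abs_def] by measurable

text \<open>The three marks of a station form a block; blocks of different stations are disjoint,
  and the fading is a function of its own block.\<close>

lemma indep_fading: "indep_vars (\<lambda>_. borel) (fading N) stations"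
proof -
  have "indep_vars (\<lambda>b. PiM (marks {b}) (\<lambda>_. borel)) (\<lambda>b \<omega>. restrict (\<lambda>i. mark N i \<omega>) (marks {b})) stations"
    by (rule indep_vars_restrict[OF indep_marks]) (auto simp: marks_def disjoint_family_on_def)
  then have "indep_vars (\<lambda>_. borel)
      (\<lambda>b \<omega>. (\<lambda>z. z (K_mark b) * z (F_mark b) * z (G_mark b)) (restrict (\<lambda>i. mark N i \<omega>) (marks {b}))) stations"
    by (rule indep_vars_compose2)
       (intro borel_measurable_times measurable_component_singleton, auto simp: marks_def)
  then show ?thesis
    by (simp add: marks_def mark_def fading_def [abs_def])
qed

text \<open>The exponential variable \<open>F\<close> is integrated with \<open>K * G\<close>
  frozen, which produces \<open>1 / (1 + x)\<close>; the finitely supported \<open>K\<close> and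
  \<open>G\<close> then contribute weighted sums.\<close>

lemma fading_laplace:
  assumes b: "b \<in> stations" and "0 \<le> c"
  shows "(\<integral>\<^sup>+\<omega>. exp_neg (ennreal (c * fading N b \<omega>)) \<partial>M)
    = ennreal (1 - p_T p / 2 + p_T p / 2 * (\<Sum>(g, q)\<leftarrow>gain_dist p. q / (1 + c * g)))"
proof -
  note [measurable] = marks_measurable[OF b]
  have K_distr: "distr M borel (K N b) = distr (measure_pmf (pmf_of_list (transmit_dist p))) borel (\<lambda>x. x)"
    and F_distr: "distributed M lborel (F N b) (exponential_density 1)"
    and G_distr: "distr M borel (G N b) = distr (measure_pmf (pmf_of_list (gain_dist p))) borel (\<lambda>x. x)"
    using network b by (auto simp: is_network_def)
  have K_int: "(\<integral>\<^sup>+\<omega>. f (K N b \<omega>) \<partial>M) = (\<Sum>(x, q)\<leftarrow>transmit_dist p. ennreal q * f x)"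
    if [measurable]: "f \<in> borel_measurable borel" for f
  proof -
    have "(\<integral>\<^sup>+\<omega>. f (K N b \<omega>) \<partial>M) = (\<integral>\<^sup>+x. f x \<partial>distr M borel (K N b))"
      by (subst nn_integral_distr) auto
    then show ?thesis
      unfolding K_distr by (simp add: nn_integral_distr nn_integral_pmf_of_list[OF transmit_dist_wf[OF params]])
  qed
  have G_int: "(\<integral>\<^sup>+\<omega>. f (G N b \<omega>) \<partial>M) = (\<Sum>(x, q)\<leftarrow>gain_dist p. ennreal q * f x)"
    if [measurable]: "f \<in> borel_measurable borel" for f
  proof -
    have "(\<integral>\<^sup>+\<omega>. f (G N b \<omega>) \<partial>M) = (\<integral>\<^sup>+x. f x \<partial>distr M borel (G N b))"
      by (subst nn_integral_distr) auto
    then show ?thesis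
      unfolding G_distr by (simp add: nn_integral_distr nn_integral_pmf_of_list[OF gain_dist_wf[OF params]])
  qed
  have F_int: "(\<integral>\<^sup>+\<omega>. exp_neg (ennreal (x * F N b \<omega>)) \<partial>M) = ennreal (1 / (1 + x))" if "0 \<le> x" for x
    using distributed_nn_integral[OF F_distr, of "\<lambda>y. ennreal (exp_neg (ennreal (x * y)))"]
      nn_integral_exponential_exp_neg[OF that] by simp
  have ind: "indep_vars (\<lambda>_. borel) (mark N) {F_mark b, K_mark b, G_mark b}"
    using indep_marks by (rule indep_vars_subset) (use b in \<open>auto simp: marks_def\<close>)
  have F_KG: "indep_var borel (F N b) borel (\<lambda>\<omega>. K N b \<omega> * G N b \<omega>)"
    using indep_vars_prod[of "{K_mark b, G_mark b}" "F_mark b" "mark N"] ind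
    by (simp add: mark_def)
  have K_G: "indep_var borel (G N b) borel (K N b)"
    using indep_vars_prod[of "{K_mark b}" "G_mark b" "mark N"] indep_vars_subset[OF ind, of "{G_mark b, K_mark b}"]
    by (simp add: mark_def)
  \<comment> \<open>Defined for all real \<open>x\<close>, since \<open>K\<close> and
    \<open>G\<close> are known only in distribution and need not be nonnegative at every point. Once
    they are integrated, only the nonnegative arguments \<open>c * g\<close> and 0 remain, where
    \<open>F_int\<close> applies.\<close>
  define L where "L x = (\<integral>\<^sup>+\<omega>. exp_neg (ennreal (x * F N b \<omega>)) \<partial>M)" for x
  have [measurable]: "L \<in> borel_measurable borel"
    unfolding L_def [abs_def] by measurable
  have "(\<integral>\<^sup>+\<omega>. exp_neg (ennreal (c * fading N b \<omega>)) \<partial>M)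
      = (\<integral>\<^sup>+\<omega>. (\<lambda>x y. ennreal (exp_neg (ennreal (c * x * y)))) (K N b \<omega> * G N b \<omega>) (F N b \<omega>) \<partial>M)"
    by (simp add: fading_def mult_ac)
  also have "\<dots> = (\<integral>\<^sup>+\<omega>. (\<integral>\<^sup>+\<omega>'. (\<lambda>x y. ennreal (exp_neg (ennreal (c * x * y)))) (K N b \<omega> * G N b \<omega>) (F N b \<omega>') \<partial>M) \<partial>M)"
    by (rule indep_var_nn_integral[OF indep_var_commute[OF F_KG]]) measurable
  also have "\<dots> = (\<integral>\<^sup>+\<omega>. L (c * (K N b \<omega> * G N b \<omega>)) \<partial>M)"
    by (simp add: L_def)
  also have "\<dots> = (\<integral>\<^sup>+\<omega>. (\<integral>\<^sup>+\<omega>'. L (c * (K N b \<omega>' * G N b \<omega>)) \<partial>M) \<partial>M)"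
    by (rule indep_var_nn_integral[OF K_G, of "\<lambda>x y. L (c * (y * x))"]) measurable
  also have "\<dots> = (\<Sum>(g, q)\<leftarrow>gain_dist p. ennreal q * (ennreal (p_T p / 2) * L (c * g) + ennreal (1 - p_T p / 2) * L 0))"
    by (subst G_int, measurable, subst K_int) (auto simp: transmit_dist_def)
  also have "\<dots> = (\<Sum>(g, q)\<leftarrow>gain_dist p. ennreal (q * (p_T p / 2 / (1 + c * g) + (1 - p_T p / 2))))"
  proof (intro arg_cong[where f = sum_list] map_cong refl, clarify)
    fix g q assume "(g, q) \<in> set (gain_dist p)"
    then have g: "0 < g" "0 \<le> q" using gain_dist_pos[OF params] by auto
    have pT: "0 \<le> p_T p" "p_T p \<le> 1"
      using params by (auto simp: valid_params_def)
    have "ennreal (p_T p / 2) * L (c * g) + ennreal (1 - p_T p / 2) * L 0 = ennreal (p_T p / 2 / (1 + c * g) + (1 - p_T p / 2))"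
      unfolding L_def using g \<open>0 \<le> c\<close> pT F_int[of "c * g"] F_int[of 0]
      by (simp flip: ennreal_mult ennreal_plus)
    then show "ennreal q * (ennreal (p_T p / 2) * L (c * g) + ennreal (1 - p_T p / 2) * L 0)
      = ennreal (q * (p_T p / 2 / (1 + c * g) + (1 - p_T p / 2)))"
      using g pT \<open>0 \<le> c\<close> by (simp add: ennreal_mult)
  qed
  also have "\<dots> = ennreal (\<Sum>(g, q)\<leftarrow>gain_dist p. q * (p_T p / 2 / (1 + c * g) + (1 - p_T p / 2)))"
  proof -
    have "(\<Sum>(g, q)\<leftarrow>xs. ennreal (h g q)) = ennreal (\<Sum>(g, q)\<leftarrow>xs. h g q)"
      if "\<And>g q. (g, q) \<in> set xs \<Longrightarrow> 0 \<le> h g q" for xs and h :: "real \<Rightarrow> real \<Rightarrow> real"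
      using that
    proof (induction xs)
      case (Cons z xs)
      then show ?case
        by (cases z) (force intro!: ennreal_plus[symmetric] sum_list_nonneg simp del: ennreal_plus)
    qed simp
    moreover have "0 \<le> q * (p_T p / 2 / (1 + c * g) + (1 - p_T p / 2))" if "(g, q) \<in> set (gain_dist p)" for g q
      using gain_dist_pos[OF params that] \<open>0 \<le> c\<close> params by (auto simp: valid_params_def)
    ultimately show ?thesis by simp
  qed
  also have "(\<Sum>(g, q)\<leftarrow>gain_dist p. q * (p_T p / 2 / (1 + c * g) + (1 - p_T p / 2)))
    = 1 - p_T p / 2 + p_T p / 2 * (\<Sum>(g, q)\<leftarrow>gain_dist p. q / (1 + c * g))"
  proof -
    have "(\<Sum>(g, q)\<leftarrow>xs. q * (x / (1 + c * g) + y))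
      = (\<Sum>(g, q)\<leftarrow>xs. q) * y + x * (\<Sum>(g, q)\<leftarrow>xs. q / (1 + c * g))" for xs x y
      by (induction xs) (auto simp: algebra_simps)
    from this[of "p_T p / 2" "1 - p_T p / 2" "gain_dist p"] show ?thesis
      unfolding gain_dist_sum by simp
  qed
  finally show ?thesis .
qed

end

section \<open>Link probabilities and bounds for the transform of a station\<close>

lemma UNIV_link: "(UNIV :: link set) = {LoS, NLoS}"
  using link.exhaust by auto

instance link :: finite
  by standard (simp add: UNIV_link)

lemma link_prob_nonneg: "valid_params p \<Longrightarrow> 0 \<le> t \<Longrightarrow> 0 \<le> link_prob p \<tau> t"
  by (cases \<tau>) (auto simp: valid_params_def)

lemma link_prob_sum: "(\<Sum>\<tau>\<in>UNIV. link_prob p \<tau> t) = 1"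
  by (simp add: UNIV_link)

lemma link_prob_le_1: "valid_params p \<Longrightarrow> 0 \<le> t \<Longrightarrow> link_prob p \<tau> t \<le> 1"
  by (cases \<tau>) (auto simp: valid_params_def)

lemma link_prob_measurable [measurable]: "link_prob p \<tau> \<in> borel_measurable borel"
proof -
  have "link_prob p LoS = (\<lambda>t. exp (- \<beta> p * t))" "link_prob p NLoS = (\<lambda>t. 1 - exp (- \<beta> p * t))"
    by auto
  then show ?thesis by (cases \<tau>) simp_all
qed

text \<open>The law of \<open>K * F * G\<close> depends neither on distance nor on link type, so
  \<open>u\<close> is this function at the coefficient
  \<open>s * C p \<tau> * t powr (- \<alpha> p \<tau>)\<close>. A silent or uncounted station is
  covered as well, by the coefficient 0.\<close>

definition mark_laplace :: "params \<Rightarrow> real \<Rightarrow> real" where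
  "mark_laplace p c = 1 - p_T p / 2 + p_T p / 2 * (\<Sum>(g, q)\<leftarrow>gain_dist p. q / (1 + c * g))"

lemma mark_laplace_measurable [measurable]: "mark_laplace p \<in> borel_measurable borel"
  unfolding mark_laplace_def [abs_def] gain_dist_def Let_def by simp

lemma u_eq_mark_laplace: "u p \<tau> s t = mark_laplace p (s * C p \<tau> * t powr (- \<alpha> p \<tau>))"
  unfolding u_def mark_laplace_def gain_dist_sum by (simp add: mult_ac)

lemma mark_laplace_0 [simp]: "mark_laplace p 0 = 1"
  by (simp add: mark_laplace_def gain_dist_sum)

text \<open>Positivity comes from the summand \<open>1 - p_T p / 2\<close>, which is at least 1/2.
  It is what later makes \<open>loss\<close> strictly less than 1 and its logarithm usable.\<close>

lemma mark_laplace_bounds: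
  assumes "valid_params p" "0 \<le> c"
  shows "0 < mark_laplace p c" "mark_laplace p c \<le> 1"
proof -
  have pT: "0 < p_T p" "p_T p \<le> 1"
    using assms by (auto simp: valid_params_def)
  have "0 \<le> (\<Sum>(g, q)\<leftarrow>gain_dist p. q / (1 + c * g))"
    using gain_dist_pos[OF assms(1)] assms(2) by (fastforce intro!: sum_list_nonneg)
  then have "0 \<le> p_T p / 2 * (\<Sum>(g, q)\<leftarrow>gain_dist p. q / (1 + c * g))"
    using pT by simp
  then show "0 < mark_laplace p c"
    using pT unfolding mark_laplace_def by linarith
  have "(\<Sum>(g, q)\<leftarrow>gain_dist p. q / (1 + c * g)) \<le> (\<Sum>(g, q)\<leftarrow>gain_dist p. q)"
  proof (rule sum_list_mono, clarify)
    fix g q assume "(g, q) \<in> set (gain_dist p)"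
    then have "0 < g" "0 \<le> q" using gain_dist_pos[OF assms(1)] by auto
    then show "q / (1 + c * g) \<le> q"
      using assms(2) by (auto simp: divide_le_eq add_pos_nonneg algebra_simps)
  qed
  then have "p_T p / 2 * (\<Sum>(g, q)\<leftarrow>gain_dist p. q / (1 + c * g)) \<le> p_T p / 2 * 1"
    using pT unfolding gain_dist_sum by (intro mult_left_mono) auto
  then show "mark_laplace p c \<le> 1"
    unfolding mark_laplace_def by linarith
qed

section \<open>Sigma-algebras of the sites, and their independence from the marks\<close>

context network_model
begin

abbreviation "class_sigma S \<equiv> sigma (space M) (class_events M N S)"
abbreviation "position_sigma \<equiv> sigma (space M) (position_events M N)"
abbreviation "site_sigma \<equiv> sigma (space M) (site_events M N)"

lemma events_Pow:
  "class_events M N S \<subseteq> Pow (space M)" "position_events M N \<subseteq> Pow (space M)" "site_events M N \<subseteq> Pow (space M)"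
proof -
  have gen: "sigma_sets (space M) A \<subseteq> Pow (space M)" if "A \<subseteq> Pow (space M)" for A
    using sigma_sets_into_sp[OF that] by auto
  show 1: "class_events M N S \<subseteq> Pow (space M)" for S
    unfolding class_events_def by (rule gen) auto
  show 2: "position_events M N \<subseteq> Pow (space M)"
    unfolding position_events_def using 1 by (intro gen UN_least) auto
  show "site_events M N \<subseteq> Pow (space M)"
    unfolding site_events_def using 2 by (intro gen Un_least) auto
qed

lemma sets_sigmas [simp]:
  "sets (class_sigma S) = class_events M N S"
  "sets position_sigma = position_events M N"
  "sets site_sigma = site_events M N"
proof -
  have gen: "sigma_sets (space M) (sigma_sets (space M) A) = sigma_sets (space M) A" if "A \<subseteq> Pow (space M)" for A
    using that by (rule sigma_sets_sigma_sets_eq)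
  show "sets (class_sigma S) = class_events M N S"
    unfolding sets_measure_of[OF events_Pow(1)] unfolding class_events_def by (rule gen) auto
  show "sets position_sigma = position_events M N"
    unfolding sets_measure_of[OF events_Pow(2)] unfolding position_events_def
    using events_Pow(1) by (intro gen UN_least) auto
  show "sets site_sigma = site_events M N"
    unfolding sets_measure_of[OF events_Pow(3)] unfolding site_events_def
    using events_Pow(2) by (intro gen Un_least) auto
qed

lemma space_sigmas [simp]:
  "space (class_sigma S) = space M" "space position_sigma = space M" "space site_sigma = space M"
  using events_Pow by (simp_all add: space_measure_of)

lemma class_events_subset: "S \<in> site_classes \<Longrightarrow> class_events M N S \<subseteq> position_events M N"
  unfolding position_events_def by auto

lemma position_events_subset: "position_events M N \<subseteq> site_events M N"
  unfolding site_events_def by auto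

lemma site_events_events: "site_events M N \<subseteq> events"
  using indep_sources by (auto simp: indep_sets_def)

lemma npts_class: "npts N S -` A \<inter> space M \<in> class_events M N S"
  unfolding class_events_def by (intro sigma_sets.Basic) auto

lemma pos_class: "A \<in> sets borel \<Longrightarrow> pos N S i -` A \<inter> space M \<in> class_events M N S"
  unfolding class_events_def by (intro sigma_sets.Basic) auto

lemma class_sigma_measurable [measurable]:
  "npts N S \<in> measurable (class_sigma S) (count_space UNIV)"
  "pos N S i \<in> borel_measurable (class_sigma S)"
  by (auto intro!: measurableI npts_class pos_class)

lemma position_sigma_measurable [measurable]:
  assumes "S \<in> site_classes"
  shows "npts N S \<in> measurable position_sigma (count_space UNIV)"
    "pos N S i \<in> borel_measurable position_sigma"
  by (auto intro!: measurableI subsetD[OF class_events_subset[OF assms]] npts_class pos_class)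

lemma site_sigma_measurable [measurable]:
  assumes "S \<in> site_classes"
  shows "npts N S \<in> measurable site_sigma (count_space UNIV)"
    "pos N S i \<in> borel_measurable site_sigma"
    "link_type N S i \<in> measurable site_sigma (count_space UNIV)"
proof -
  show "npts N S \<in> measurable site_sigma (count_space UNIV)"
    "pos N S i \<in> borel_measurable site_sigma"
    by (auto intro!: measurableI subsetD[OF position_events_subset]
        subsetD[OF class_events_subset[OF assms]] npts_class pos_class)
  have "link_type N S i -` A \<inter> space M \<in> site_events M N" for A
    unfolding site_events_def using assms by (intro sigma_sets.Basic) auto
  then show "link_type N S i \<in> measurable site_sigma (count_space UNIV)"
    by (auto intro!: measurableI)
qed

text \<open>Lets the sample point itself, seen only through the events of the sites, act as a random
  variable that can be frozen.\<close>

lemma site_sigma_M: "(\<lambda>\<omega>. \<omega>) \<in> measurable M site_sigma"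
  using site_events_events by (intro measurableI) auto

lemma position_sigma_M: "(\<lambda>\<omega>. \<omega>) \<in> measurable M position_sigma"
  using site_events_events position_events_subset by (intro measurableI) auto

lemma M_measurable [measurable]:
  assumes "S \<in> site_classes"
  shows "npts N S \<in> measurable M (count_space UNIV)"
    "pos N S i \<in> borel_measurable M"
    "link_type N S i \<in> measurable M (count_space UNIV)"
  using measurable_compose[OF site_sigma_M] site_sigma_measurable[OF assms] by auto

text \<open>The sources are split into the block \<open>Sites\<close> and the block of all marks of
  \<open>A\<close>. Independence passes to the sigma-algebras generated by the blocks, and the whole
  vector of fadings is measurable for the second one.\<close>

lemma indep_sites_fading:
  assumes A: "A \<subseteq> stations" and E: "E \<in> sets site_sigma" and X: "X \<in> sets (PiM A (\<lambda>_. borel))"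
  shows "prob ((\<lambda>\<omega>. (\<omega>, \<lambda>b\<in>A. fading N b \<omega>)) -` (E \<times> X) \<inter> space M)
    = prob ((\<lambda>\<omega>. \<omega>) -` E \<inter> space M) * prob ((\<lambda>\<omega>. \<lambda>b\<in>A. fading N b \<omega>) -` X \<inter> space M)"
proof -
  let ?I = "case_bool {Sites} (marks A)"
  let ?E = "\<lambda>j. sigma_sets (space M) (\<Union>b\<in>?I j. source_events M N b)"
  have "marks A \<subseteq> marks stations"
    using A by (auto simp: marks_def)
  have ind: "indep_sets ?E UNIV"
  proof (rule indep_sets_collect_sigma)
    show "indep_sets (source_events M N) (\<Union>j\<in>UNIV. ?I j)"
      using \<open>marks A \<subseteq> marks stations\<close>
      by (intro indep_sets_mono_index[OF _ indep_sources]) (auto split: bool.splits)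
    show "disjoint_family_on ?I UNIV"
      by (auto simp: disjoint_family_on_def marks_def split: bool.splits)
    show "Int_stable (source_events M N b)" for b
    proof (cases "b = Sites")
      case True
      then show ?thesis using sets.Int[of _ site_sigma] by (simp add: Int_stable_def)
    next
      case False
      show ?thesis
      proof (rule Int_stableI)
        fix U V assume "U \<in> source_events M N b" "V \<in> source_events M N b"
        then obtain X Y where "X \<in> sets borel" "U = mark N b -` X \<inter> space M"
            "Y \<in> sets borel" "V = mark N b -` Y \<inter> space M"
          unfolding source_events_mark[OF False] by blast
        then have "U \<inter> V = mark N b -` (X \<inter> Y) \<inter> space M" "X \<inter> Y \<in> sets borel"
          by auto
        then show "U \<inter> V \<in> source_events M N b"
          unfolding source_events_mark[OF False] by blast
      qed
    qed
  qed
  have marks_sub: "(\<Union>b\<in>marks A. source_events M N b) \<subseteq> Pow (space M)"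
    by (auto simp: marks_def)
  have gen: "mark N b \<in> borel_measurable (sigma (space M) (\<Union>b\<in>marks A. source_events M N b))" if b: "b \<in> marks A" for b
  proof (rule measurableI)
    fix X :: "real set" assume X: "X \<in> sets borel"
    have "b \<noteq> Sites"
      using b by (auto simp: marks_def)
    then have "mark N b -` X \<inter> space M \<in> source_events M N b"
      using X by (subst source_events_mark) blast+
    then show "mark N b -` X \<inter> space (sigma (space M) (\<Union>b\<in>marks A. source_events M N b))
        \<in> sets (sigma (space M) (\<Union>b\<in>marks A. source_events M N b))"
      unfolding space_measure_of[OF marks_sub] sets_measure_of[OF marks_sub]
      using b by (intro sigma_sets.Basic) blast
  qed simp
  have "(\<lambda>\<omega>. mark N (K_mark b) \<omega> * mark N (F_mark b) \<omega> * mark N (G_mark b) \<omega>)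
      \<in> borel_measurable (sigma (space M) (\<Union>b\<in>marks A. source_events M N b))" if "b \<in> A" for b
    using that by (intro borel_measurable_times gen) (auto simp: marks_def)
  then have Y: "(\<lambda>\<omega>. \<lambda>b\<in>A. fading N b \<omega>)
      \<in> measurable (sigma (space M) (\<Union>b\<in>marks A. source_events M N b)) (PiM A (\<lambda>_. borel))"
    by (intro measurable_restrict) (simp add: mark_def fading_def [abs_def])
  have E': "E \<in> site_events M N" "E \<subseteq> space M"
    using E events_Pow(3) by auto
  have "(\<lambda>\<omega>. \<lambda>b\<in>A. fading N b \<omega>) -` X \<inter> space M \<in> ?E False"
    using measurable_sets[OF Y X] unfolding space_measure_of[OF marks_sub] sets_measure_of[OF marks_sub] by simp
  moreover have "indep_set (?E True) (?E False)"
    unfolding indep_set_def by (rule indep_sets_mono_sets[OF ind]) (auto split: bool.splits)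
  ultimately have "prob (E \<inter> ((\<lambda>\<omega>. \<lambda>b\<in>A. fading N b \<omega>) -` X \<inter> space M))
      = prob E * prob ((\<lambda>\<omega>. \<lambda>b\<in>A. fading N b \<omega>) -` X \<inter> space M)"
    using E' by (intro indep_setD[of "?E True" "?E False"]) simp_all
  moreover have "(\<lambda>\<omega>. (\<omega>, \<lambda>b\<in>A. fading N b \<omega>)) -` (E \<times> X) \<inter> space M
      = E \<inter> ((\<lambda>\<omega>. \<lambda>b\<in>A. fading N b \<omega>) -` X \<inter> space M)"
    by auto
  ultimately show ?thesis
    using E' by (simp add: Int_absorb2)
qed

lemma fading_vector_measurable:
  "A \<subseteq> stations \<Longrightarrow> (\<lambda>\<omega>. \<lambda>b\<in>A. fading N b \<omega>) \<in> measurable M (PiM A (\<lambda>_. borel))"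
  by (intro measurable_restrict) auto

text \<open>The coefficients \<open>c b\<close> may depend on the sites but not on the marks. With
  the sites frozen they are constants, and the independent fadings of the finitely many stations
  factor.\<close>

lemma integrate_marks:
  fixes c :: "station \<Rightarrow> 'w \<Rightarrow> real"
  assumes A: "finite A" "A \<subseteq> stations"
    and c: "\<And>b. b \<in> A \<Longrightarrow> c b \<in> borel_measurable site_sigma" "\<And>b \<omega>. b \<in> A \<Longrightarrow> 0 \<le> c b \<omega>"
  shows "(\<integral>\<^sup>+\<omega>. (\<Prod>b\<in>A. ennreal (exp_neg (ennreal (c b \<omega> * fading N b \<omega>)))) \<partial>M)
    = (\<integral>\<^sup>+\<omega>. (\<Prod>b\<in>A. ennreal (mark_laplace p (c b \<omega>))) \<partial>M)"
proof -
  have "(\<integral>\<^sup>+\<omega>. (\<Prod>b\<in>A. ennreal (exp_neg (ennreal (c b \<omega> * fading N b \<omega>)))) \<partial>M)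
      = (\<integral>\<^sup>+\<omega>. (\<lambda>\<omega> z. \<Prod>b\<in>A. ennreal (exp_neg (ennreal (c b \<omega> * z b)))) \<omega> (\<lambda>b\<in>A. fading N b \<omega>) \<partial>M)"
    by (auto intro!: nn_integral_cong prod.cong)
  also have "\<dots> = (\<integral>\<^sup>+\<omega>. (\<integral>\<^sup>+\<omega>'. (\<lambda>\<omega> z. \<Prod>b\<in>A. ennreal (exp_neg (ennreal (c b \<omega> * z b)))) \<omega> (\<lambda>b\<in>A. fading N b \<omega>') \<partial>M) \<partial>M)"
  proof (rule nn_integral_independent[OF site_sigma_M fading_vector_measurable[OF A(2)] indep_sites_fading[OF A(2)]])
    have [measurable]: "(\<lambda>z. c b (fst z)) \<in> borel_measurable (site_sigma \<Otimes>\<^sub>M PiM A (\<lambda>_. borel))"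
      "(\<lambda>z. snd z b) \<in> borel_measurable (site_sigma \<Otimes>\<^sub>M PiM A (\<lambda>_. borel :: real measure))" if "b \<in> A" for b
      using measurable_compose[OF measurable_fst c(1)[OF that]]
        measurable_compose[OF measurable_snd measurable_component_singleton[OF that]] by auto
    show "(\<lambda>(\<omega>, z). \<Prod>b\<in>A. ennreal (exp_neg (ennreal (c b \<omega> * z b))))
      \<in> borel_measurable (site_sigma \<Otimes>\<^sub>M PiM A (\<lambda>_. borel))"
      unfolding case_prod_unfold by measurable
  qed
  also have "\<dots> = (\<integral>\<^sup>+\<omega>. (\<Prod>b\<in>A. ennreal (mark_laplace p (c b \<omega>))) \<partial>M)"
  proof (rule nn_integral_cong)
    fix \<omega>
    have "(\<integral>\<^sup>+\<omega>'. (\<Prod>b\<in>A. ennreal (exp_neg (ennreal (c b \<omega> * fading N b \<omega>')))) \<partial>M)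
        = (\<Prod>b\<in>A. \<integral>\<^sup>+\<omega>'. ennreal (exp_neg (ennreal (c b \<omega> * fading N b \<omega>'))) \<partial>M)"
      using A indep_vars_subset[OF indep_fading A(2)]
      by (intro indep_vars_nn_integral indep_vars_compose2[where X = "fading N" and Y = "\<lambda>b x. ennreal (exp_neg (ennreal (c b \<omega> * x)))"]) auto
    also have "\<dots> = (\<Prod>b\<in>A. ennreal (mark_laplace p (c b \<omega>)))"
      using A c(2) by (intro prod.cong refl) (subst fading_laplace, auto simp: mark_laplace_def)
    finally show "(\<integral>\<^sup>+\<omega>'. (\<lambda>\<omega> z. \<Prod>b\<in>A. ennreal (exp_neg (ennreal (c b \<omega> * z b)))) \<omega> (\<lambda>b\<in>A. fading N b \<omega>') \<partial>M)
        = (\<Prod>b\<in>A. ennreal (mark_laplace p (c b \<omega>)))"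
      by simp
  qed
  finally show ?thesis .
qed

end

section \<open>Integration of the link types\<close>

context network_model
begin

lemma link_event_measurable:
  assumes J: "finite J" "J \<subseteq> site_classes \<times> UNIV"
  shows "{\<omega>\<in>space M. \<forall>(S, i)\<in>J. link_type N S i \<omega> = \<sigma> (S, i)} \<in> sets M"
proof -
  have "{\<omega>\<in>space M. link_type N S i \<omega> = \<sigma> (S, i)} \<in> sets M" if "(S, i) \<in> J" for S i
    using measurable_sets[OF M_measurable(3), of S "{\<sigma> (S, i)}" i] that J
    by (auto simp: vimage_def Int_def conj_commute)
  then show ?thesis
    using J by (intro sets.sets_Collect_finite_All) auto
qed

text \<open>For \<open>w\<close> the indicator of a position event this is the conditional law of
  the link types in \<open>is_network\<close>. That determines a measure on the position events,
  hence the integral of every nonnegative position-measurable \<open>w\<close>.\<close>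

lemma integrate_link_event:
  fixes w :: "'w \<Rightarrow> ennreal"
  assumes J: "finite J" "J \<subseteq> site_classes \<times> UNIV" and w: "w \<in> borel_measurable position_sigma"
  shows "(\<integral>\<^sup>+\<omega>. w \<omega> * indicator {\<omega>\<in>space M. \<forall>(S, i)\<in>J. link_type N S i \<omega> = \<sigma> (S, i)} \<omega> \<partial>M)
    = (\<integral>\<^sup>+\<omega>. w \<omega> * (\<Prod>(S, i)\<in>J. ennreal (link_prob p (\<sigma> (S, i)) (norm (pos N S i \<omega>)))) \<partial>M)"
proof -
  define L where "L = {\<omega>\<in>space M. \<forall>(S, i)\<in>J. link_type N S i \<omega> = \<sigma> (S, i)}"
  define q where "q \<omega> = (\<Prod>(S, i)\<in>J. link_prob p (\<sigma> (S, i)) (norm (pos N S i \<omega>)))" for \<omega>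
  have [measurable]: "L \<in> sets M"
    unfolding L_def by (rule link_event_measurable[OF J])
  have [measurable]: "q \<in> borel_measurable M"
    unfolding q_def [abs_def] case_prod_unfold using J
    by (intro borel_measurable_prod measurable_compose[OF _ link_prob_measurable] borel_measurable_norm M_measurable) auto
  have q: "0 \<le> q \<omega>" "q \<omega> \<le> 1" for \<omega>
    unfolding q_def using link_prob_nonneg[OF params] link_prob_le_1[OF params]
    by (auto intro!: prod_nonneg prod_le_1 simp: case_prod_unfold)
  \<comment> \<open>The measure with density \<open>f\<close>, restricted to the sigma-algebra of
    positions.\<close>
  let ?P = "\<lambda>f. distr (density M f) position_sigma (\<lambda>\<omega>. \<omega>)"
  have sp: "(\<lambda>\<omega>. \<omega>) \<in> measurable (density M f) position_sigma" for f
    using position_sigma_M by (simp cong: measurable_cong_sets)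
  have "?P (indicator L) = ?P (\<lambda>\<omega>. ennreal (q \<omega>))"
  proof (rule measure_eqI)
    fix E assume "E \<in> sets (?P (indicator L))"
    then have E: "E \<in> position_events M N"
      by simp
    then have [measurable]: "E \<in> sets M" and EM: "E \<subseteq> space M"
      using position_events_subset site_events_events events_Pow by auto
    have E': "E \<in> sets position_sigma"
      using E by simp
    have "emeasure (?P (indicator L)) E = emeasure M {\<omega>\<in>E. \<forall>(S, i)\<in>J. link_type N S i \<omega> = \<sigma> (S, i)}"
    proof -
      have "emeasure (?P (indicator L)) E = (\<integral>\<^sup>+\<omega>. indicator L \<omega> * indicator E \<omega> \<partial>M)"
        using EM by (simp add: emeasure_distr[OF sp E'] Int_absorb2 emeasure_density)
      also have "\<dots> = (\<integral>\<^sup>+\<omega>. indicator (E \<inter> L) \<omega> \<partial>M)"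
        by (intro nn_integral_cong) (auto split: split_indicator)
      also have "\<dots> = emeasure M (E \<inter> L)"
        by simp
      also have "E \<inter> L = {\<omega>\<in>E. \<forall>(S, i)\<in>J. link_type N S i \<omega> = \<sigma> (S, i)}"
        using EM by (auto simp: L_def)
      finally show ?thesis .
    qed
    also have "\<dots> = ennreal (LINT \<omega>:E|M. q \<omega>)"
    proof -
      have *: "\<forall>J \<sigma>. \<forall>E\<in>position_events M N. finite J \<longrightarrow> J \<subseteq> site_classes \<times> UNIV \<longrightarrow>
        measure M {\<omega>\<in>E. \<forall>(S, i)\<in>J. link_type N S i \<omega> = \<sigma> S i} =
        (LINT \<omega>:E|M. (\<Prod>(S, i)\<in>J. link_prob p (\<sigma> S i) (norm (pos N S i \<omega>))))"
        using network unfolding is_network_def by (elim conjE)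
      show ?thesis
        unfolding q_def emeasure_eq_measure by (subst *[rule_format, OF E J, of "\<lambda>S i. \<sigma> (S, i)"]) (rule refl)
    qed
    also have "\<dots> = (\<integral>\<^sup>+\<omega>. ennreal (q \<omega>) * indicator E \<omega> \<partial>M)"
    proof -
      have "integrable M (\<lambda>\<omega>. indicator E \<omega> * q \<omega>)"
        using q by (intro integrable_const_bound[where B = 1]) (auto simp: abs_mult split: split_indicator)
      then have "(\<integral>\<^sup>+\<omega>. ennreal (indicator E \<omega> * q \<omega>) \<partial>M) = ennreal (\<integral>\<omega>. indicator E \<omega> * q \<omega> \<partial>M)"
        using q by (intro nn_integral_eq_integral) auto
      then show ?thesis
        using q by (simp add: set_lebesgue_integral_def ennreal_mult ennreal_indicator mult.commute)
    qed
    also have "\<dots> = emeasure (?P (\<lambda>\<omega>. ennreal (q \<omega>))) E"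
      using EM by (simp add: emeasure_distr[OF sp E'] Int_absorb2 emeasure_density)
    finally show "emeasure (?P (indicator L)) E = emeasure (?P (\<lambda>\<omega>. ennreal (q \<omega>))) E" .
  qed simp
  note eq = this
  have int: "(\<integral>\<^sup>+\<omega>. w \<omega> \<partial>?P f) = (\<integral>\<^sup>+\<omega>. w \<omega> * f \<omega> \<partial>M)" if [measurable]: "f \<in> borel_measurable M" for f
    using measurable_compose[OF position_sigma_M w] w
    by (simp add: nn_integral_distr[OF sp] nn_integral_density mult.commute)
  have "(\<integral>\<^sup>+\<omega>. w \<omega> * indicator L \<omega> \<partial>M) = (\<integral>\<^sup>+\<omega>. w \<omega> * ennreal (q \<omega>) \<partial>M)"
    using int[of "indicator L"] int[of "\<lambda>\<omega>. ennreal (q \<omega>)"] eq by simp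
  then show ?thesis
    using link_prob_nonneg[OF params] by (simp add: L_def q_def prod_ennreal case_prod_unfold)
qed

text \<open>The expectation is split over the finitely many link assignments on \<open>J\<close>.
  Each one contributes a product of link probabilities, and the distributive law collects the sum
  over assignments into a product of averages per site.\<close>

lemma integrate_link_types:
  fixes h :: "nat set \<times> nat \<Rightarrow> 'w \<Rightarrow> ennreal"
  assumes J: "finite J" "J \<subseteq> site_classes \<times> UNIV"
    and h: "\<And>j. j \<in> J \<Longrightarrow> h j \<in> borel_measurable position_sigma"
  shows "(\<integral>\<^sup>+\<omega>. (\<Prod>(S, i)\<in>J. if link_type N S i \<omega> = \<tau> then h (S, i) \<omega> else 1) \<partial>M)
    = (\<integral>\<^sup>+\<omega>. (\<Prod>(S, i)\<in>J. \<Sum>l\<in>UNIV. ennreal (link_prob p l (norm (pos N S i \<omega>))) * (if l = \<tau> then h (S, i) \<omega> else 1)) \<partial>M)"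
proof -
  \<comment> \<open>Extensional functions make the assignment realized at a sample point unique; it
    is \<open>\<sigma>0\<close> below.\<close>
  let ?\<Sigma> = "PiE J (\<lambda>_. UNIV) :: (nat set \<times> nat \<Rightarrow> link) set"
  define w where "w \<sigma> \<omega> = (\<Prod>(S, i)\<in>J. if \<sigma> (S, i) = \<tau> then h (S, i) \<omega> else 1)" for \<sigma> \<omega>
  have fin: "finite ?\<Sigma>"
    using J by (intro finite_PiE) auto
  have w [measurable]: "w \<sigma> \<in> borel_measurable position_sigma" for \<sigma>
    unfolding w_def [abs_def] case_prod_unfold using h
    by (intro borel_measurable_prod_ennreal) auto
  have wM: "w \<sigma> \<in> borel_measurable M" for \<sigma>
    using measurable_compose[OF position_sigma_M w] .
  have LM: "{\<omega>\<in>space M. \<forall>(S, i)\<in>J. link_type N S i \<omega> = \<sigma> (S, i)} \<in> sets M" for \<sigma>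
    by (rule link_event_measurable[OF J])
  have pM: "(\<lambda>\<omega>. ennreal (link_prob p l (norm (pos N S i \<omega>)))) \<in> borel_measurable M" if "(S, i) \<in> J" for S i l
    using that J by (intro measurable_compose[OF _ measurable_ennreal] measurable_compose[OF _ link_prob_measurable] borel_measurable_norm M_measurable) auto
  have "(\<integral>\<^sup>+\<omega>. (\<Prod>(S, i)\<in>J. if link_type N S i \<omega> = \<tau> then h (S, i) \<omega> else 1) \<partial>M)
      = (\<integral>\<^sup>+\<omega>. (\<Sum>\<sigma>\<in>?\<Sigma>. w \<sigma> \<omega> * indicator {\<omega>\<in>space M. \<forall>(S, i)\<in>J. link_type N S i \<omega> = \<sigma> (S, i)} \<omega>) \<partial>M)"
  proof (rule nn_integral_cong)
    fix \<omega> assume "\<omega> \<in> space M"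
    define \<sigma>0 where "\<sigma>0 = restrict (\<lambda>(S, i). link_type N S i \<omega>) J"
    have "(\<Sum>\<sigma>\<in>?\<Sigma>. w \<sigma> \<omega> * indicator {\<omega>\<in>space M. \<forall>(S, i)\<in>J. link_type N S i \<omega> = \<sigma> (S, i)} \<omega>)
        = (\<Sum>\<sigma>\<in>?\<Sigma>. if \<sigma> = \<sigma>0 then w \<sigma> \<omega> else 0)"
    proof (rule sum.cong)
      fix \<sigma> assume \<sigma>: "\<sigma> \<in> ?\<Sigma>"
      have "(\<forall>(S, i)\<in>J. link_type N S i \<omega> = \<sigma> (S, i)) \<longleftrightarrow> \<sigma> = \<sigma>0"
      proof
        assume "\<forall>(S, i)\<in>J. link_type N S i \<omega> = \<sigma> (S, i)"
        then show "\<sigma> = \<sigma>0"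
          by (intro PiE_ext[OF \<sigma>, of \<sigma>0]) (auto simp: \<sigma>0_def)
      qed (auto simp: \<sigma>0_def)
      then show "w \<sigma> \<omega> * indicator {\<omega>\<in>space M. \<forall>(S, i)\<in>J. link_type N S i \<omega> = \<sigma> (S, i)} \<omega>
          = (if \<sigma> = \<sigma>0 then w \<sigma> \<omega> else 0)"
        using \<open>\<omega> \<in> space M\<close> by (auto simp: indicator_def)
    qed simp
    also have "\<dots> = w \<sigma>0 \<omega>"
      using fin by (subst sum.delta) (auto simp: \<sigma>0_def)
    also have "\<dots> = (\<Prod>(S, i)\<in>J. if link_type N S i \<omega> = \<tau> then h (S, i) \<omega> else 1)"
      unfolding w_def by (intro prod.cong) (auto simp: \<sigma>0_def)
    finally show "(\<Prod>(S, i)\<in>J. if link_type N S i \<omega> = \<tau> then h (S, i) \<omega> else 1)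
        = (\<Sum>\<sigma>\<in>?\<Sigma>. w \<sigma> \<omega> * indicator {\<omega>\<in>space M. \<forall>(S, i)\<in>J. link_type N S i \<omega> = \<sigma> (S, i)} \<omega>)" ..
  qed
  also have "\<dots> = (\<Sum>\<sigma>\<in>?\<Sigma>. \<integral>\<^sup>+\<omega>. w \<sigma> \<omega> * indicator {\<omega>\<in>space M. \<forall>(S, i)\<in>J. link_type N S i \<omega> = \<sigma> (S, i)} \<omega> \<partial>M)"
    by (intro nn_integral_sum borel_measurable_times_ennreal wM borel_measurable_indicator LM)
  also have "\<dots> = (\<Sum>\<sigma>\<in>?\<Sigma>. \<integral>\<^sup>+\<omega>. w \<sigma> \<omega> * (\<Prod>(S, i)\<in>J. ennreal (link_prob p (\<sigma> (S, i)) (norm (pos N S i \<omega>)))) \<partial>M)"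
    by (intro sum.cong refl integrate_link_event J w)
  also have "\<dots> = (\<integral>\<^sup>+\<omega>. (\<Sum>\<sigma>\<in>?\<Sigma>. w \<sigma> \<omega> * (\<Prod>(S, i)\<in>J. ennreal (link_prob p (\<sigma> (S, i)) (norm (pos N S i \<omega>))))) \<partial>M)"
    unfolding case_prod_unfold
    by (intro nn_integral_sum[symmetric] borel_measurable_times_ennreal wM borel_measurable_prod_ennreal pM) auto
  also have "\<dots> = (\<integral>\<^sup>+\<omega>. (\<Prod>(S, i)\<in>J. \<Sum>l\<in>UNIV. ennreal (link_prob p l (norm (pos N S i \<omega>))) * (if l = \<tau> then h (S, i) \<omega> else 1)) \<partial>M)"
  proof (rule nn_integral_cong)
    fix \<omega>
    have "(\<Sum>\<sigma>\<in>?\<Sigma>. w \<sigma> \<omega> * (\<Prod>(S, i)\<in>J. ennreal (link_prob p (\<sigma> (S, i)) (norm (pos N S i \<omega>)))))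
        = (\<Sum>\<sigma>\<in>?\<Sigma>. \<Prod>j\<in>J. ennreal (link_prob p (\<sigma> j) (norm (pos N (fst j) (snd j) \<omega>))) * (if \<sigma> j = \<tau> then h j \<omega> else 1))"
      unfolding w_def case_prod_unfold prod.distrib prod.collapse by (simp only: mult.commute)
    also have "\<dots> = (\<Prod>j\<in>J. \<Sum>l\<in>UNIV. ennreal (link_prob p l (norm (pos N (fst j) (snd j) \<omega>))) * (if l = \<tau> then h j \<omega> else 1))"
      using J by (intro prod_sum_PiE[symmetric]) auto
    finally show "(\<Sum>\<sigma>\<in>?\<Sigma>. w \<sigma> \<omega> * (\<Prod>(S, i)\<in>J. ennreal (link_prob p (\<sigma> (S, i)) (norm (pos N S i \<omega>)))))
        = (\<Prod>(S, i)\<in>J. \<Sum>l\<in>UNIV. ennreal (link_prob p l (norm (pos N S i \<omega>))) * (if l = \<tau> then h (S, i) \<omega> else 1))"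
      unfolding case_prod_unfold prod.collapse .
  qed
  finally show ?thesis .
qed

end

section \<open>Interference components\<close>

lemma exp_neg_minus_ln: "0 \<le> x \<Longrightarrow> x < 1 \<Longrightarrow> exp_neg (ennreal (- ln (1 - x))) = 1 - x"
  by (subst exp_neg_ennreal) auto

lemma u_measurable [measurable]: "(\<lambda>t. u p \<tau> s t) \<in> borel_measurable borel"
  unfolding u_eq_mark_laplace by measurable

lemma u_bounds:
  assumes "valid_params p" "0 \<le> s"
  shows "0 < u p \<tau> s t" "u p \<tau> s t \<le> 1"
proof -
  have "0 \<le> s * C p \<tau> * t powr (- \<alpha> p \<tau>)"
    using assms by (auto simp: valid_params_def less_imp_le)
  then show "0 < u p \<tau> s t" "u p \<tau> s t \<le> 1"
    unfolding u_eq_mark_laplace using mark_laplace_bounds[OF assms(1)] by auto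
qed

text \<open>One minus the factor that a site at \<open>y\<close> contributes on average, given its
  position; in the Poisson exponent this is the integrand. The exponent \<open>card S\<close> counts
  the stations sharing the site.\<close>

definition loss :: "params \<Rightarrow> link \<Rightarrow> real \<Rightarrow> (nat set \<Rightarrow> (real^2) set) \<Rightarrow> nat set \<Rightarrow> real^2 \<Rightarrow> real" where
  "loss p \<tau> s R S y = (if y \<in> R S then link_prob p \<tau> (norm y) * (1 - u p \<tau> s (norm y) ^ card S) else 0)"

lemma loss_bounds:
  assumes "valid_params p" "0 \<le> s"
  shows "0 \<le> loss p \<tau> s R S y" "loss p \<tau> s R S y < 1"
proof -
  have "0 < u p \<tau> s (norm y) ^ card S" "u p \<tau> s (norm y) ^ card S \<le> 1"
    using u_bounds[OF assms] by (auto intro!: power_le_one less_imp_le[OF u_bounds(1)[OF assms]])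
  moreover have "0 \<le> link_prob p \<tau> (norm y)" "link_prob p \<tau> (norm y) \<le> 1"
    using link_prob_nonneg[OF assms(1)] link_prob_le_1[OF assms(1)] by auto
  moreover have "link_prob p \<tau> (norm y) * (1 - u p \<tau> s (norm y) ^ card S) \<le> 1 * (1 - u p \<tau> s (norm y) ^ card S)"
    using calculation by (intro mult_right_mono) auto
  ultimately show "0 \<le> loss p \<tau> s R S y" "loss p \<tau> s R S y < 1"
    by (auto simp: loss_def)
qed

lemma loss_measurable:
  assumes [measurable]: "R S \<in> sets borel"
  shows "loss p \<tau> s R S \<in> borel_measurable borel"
  unfolding loss_def [abs_def] by measurable

text \<open>Defined so that \<open>exp_neg\<close> returns \<open>1 - loss\<close>: a product over
  sites becomes \<open>exp_neg\<close> of a sum over points, to which \<open>PPP_laplace\<close>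
  applies.\<close>

definition cost :: "params \<Rightarrow> link \<Rightarrow> real \<Rightarrow> (nat set \<Rightarrow> (real^2) set) \<Rightarrow> nat set \<Rightarrow> real^2 \<Rightarrow> ennreal" where
  "cost p \<tau> s R S y = ennreal (- ln (1 - loss p \<tau> s R S y))"

lemma exp_neg_cost:
  "valid_params p \<Longrightarrow> 0 \<le> s \<Longrightarrow> exp_neg (cost p \<tau> s R S y) = 1 - loss p \<tau> s R S y"
  unfolding cost_def by (intro exp_neg_minus_ln loss_bounds)

lemma cost_measurable: "R S \<in> sets borel \<Longrightarrow> cost p \<tau> s R S \<in> borel_measurable borel"
  unfolding cost_def [abs_def]
  by (intro measurable_compose[OF _ measurable_ennreal] borel_measurable_uminus borel_measurable_ln
      borel_measurable_diff borel_measurable_const loss_measurable)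

section \<open>Truncation to finitely many stations\<close>

definition site_term ::
    "params \<Rightarrow> 'w network \<Rightarrow> link \<Rightarrow> (nat set \<Rightarrow> (real^2) set) \<Rightarrow> nat set \<Rightarrow> nat \<Rightarrow> 'w \<Rightarrow> ennreal" where
  "site_term p N \<tau> R S i \<omega> =
    (if enat i < npts N S \<omega> \<and> link_type N S i \<omega> = \<tau> \<and> pos N S i \<omega> \<in> R S
     then \<Sum>n\<in>S. received p N \<tau> (BS S i n) (norm (pos N S i \<omega>)) \<omega> else 0)"

text \<open>A deterministic index set: stations with index below \<open>m\<close> belong to it
  whether or not the index is a point of the process, and \<open>Colocated\<close> always does. All
  randomness of the point number, link types and regions is moved into coefficients.\<close>

definition first_stations :: "nat \<Rightarrow> station set" where
  "first_stations m = insert Colocated ((\<lambda>((S, i), n). BS S i n) ` (SIGMA j:site_classes \<times> {..<m}. fst j))"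

lemma first_stations: "finite (first_stations m)" "first_stations m \<subseteq> stations"
  by (auto simp: first_stations_def stations_def intro!: finite_SigmaI)

lemma inj_BS: "inj_on (\<lambda>((S, i), n). BS S i n) X"
  by (auto simp: inj_on_def)

lemma sum_first_stations:
  fixes f :: "station \<Rightarrow> 'b :: comm_monoid_add"
  shows "(\<Sum>b\<in>first_stations m. f b)
    = f Colocated + (\<Sum>S\<in>site_classes. \<Sum>i<m. \<Sum>n\<in>S. f (BS S i n))"
proof -
  let ?X = "SIGMA j:site_classes \<times> {..<m}. fst j" and ?g = "\<lambda>((S, i), n). BS S i n"
  have "(\<Sum>b\<in>first_stations m. f b) = f Colocated + (\<Sum>b\<in>?g ` ?X. f b)"
    unfolding first_stations_def by (intro sum.insert) (auto intro!: finite_SigmaI)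
  also have "(\<Sum>b\<in>?g ` ?X. f b) = (\<Sum>(j, n)\<in>?X. f (BS (fst j) (snd j) n))"
    by (subst sum.reindex[OF inj_BS]) (auto simp: case_prod_unfold comp_def)
  also have "\<dots> = (\<Sum>j\<in>site_classes \<times> {..<m}. \<Sum>n\<in>fst j. f (BS (fst j) (snd j) n))"
    by (intro sum.Sigma[symmetric]) auto
  also have "\<dots> = (\<Sum>S\<in>site_classes. \<Sum>i<m. \<Sum>n\<in>S. f (BS S i n))"
    unfolding sum.cartesian_product[of "\<lambda>S i. \<Sum>n\<in>S. f (BS S i n)"] case_prod_unfold ..
  finally show ?thesis .
qed

lemma prod_first_stations:
  fixes f :: "station \<Rightarrow> 'b :: comm_monoid_mult"
  shows "(\<Prod>b\<in>first_stations m. f b)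
    = f Colocated * (\<Prod>(S, i)\<in>site_classes \<times> {..<m}. \<Prod>n\<in>S. f (BS S i n))"
proof -
  let ?X = "SIGMA j:site_classes \<times> {..<m}. fst j" and ?g = "\<lambda>((S, i), n). BS S i n"
  have "(\<Prod>b\<in>first_stations m. f b) = f Colocated * (\<Prod>b\<in>?g ` ?X. f b)"
    unfolding first_stations_def by (intro prod.insert) (auto intro!: finite_SigmaI)
  also have "(\<Prod>b\<in>?g ` ?X. f b) = (\<Prod>(j, n)\<in>?X. f (BS (fst j) (snd j) n))"
    by (subst prod.reindex[OF inj_BS]) (auto simp: case_prod_unfold comp_def)
  also have "\<dots> = (\<Prod>j\<in>site_classes \<times> {..<m}. \<Prod>n\<in>fst j. f (BS (fst j) (snd j) n))"
    by (intro prod.Sigma[symmetric]) auto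
  finally show ?thesis
    by (simp add: case_prod_unfold)
qed

context network_model
begin

text \<open>Marks and link types are integrated out, leaving an expectation that involves the
  positions alone. The co-located station is at the deterministic distance \<open>r\<close>, so its
  factor comes out as a constant.\<close>

lemma truncated_laplace:
  assumes R: "\<And>S. S \<in> site_classes \<Longrightarrow> R S \<in> sets borel" and s: "0 \<le> s"
  shows "(\<integral>\<^sup>+\<omega>. exp_neg (ennreal s * ((\<Sum>S\<in>site_classes. \<Sum>i<m. site_term p N \<tau> R S i \<omega>)
      + (if col then received p N \<tau> Colocated r \<omega> else 0))) \<partial>M)
    = ennreal (if col then u p \<tau> s r else 1) *
      (\<integral>\<^sup>+\<omega>. exp_neg (\<Sum>S\<in>site_classes. \<Sum>i<m. if enat i < npts N S \<omega> then cost p \<tau> s R S (pos N S i \<omega>) else 0) \<partial>M)"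
proof -
  \<comment> \<open>The coefficient of the fading of \<open>b\<close> in the exponent. It is 0 for a
    station that is not counted, whose factor is then \<open>mark_laplace p 0 = 1\<close>.\<close>
  define c where "c b \<omega> = (case b of
      BS S i n \<Rightarrow> if enat i < npts N S \<omega> \<and> link_type N S i \<omega> = \<tau> \<and> pos N S i \<omega> \<in> R S
        then s * C p \<tau> * norm (pos N S i \<omega>) powr (- \<alpha> p \<tau>) else 0
    | Colocated \<Rightarrow> if col then s * C p \<tau> * r powr (- \<alpha> p \<tau>) else 0)" for b \<omega>
  \<comment> \<open>The factor of a site once its marks are integrated. The link type is kept out of
    it, so that \<open>h\<close> is measurable for the positions, as
    \<open>integrate_link_types\<close> demands.\<close>
  define h where "h = (\<lambda>(S, i) \<omega>. if enat i < npts N S \<omega> \<and> pos N S i \<omega> \<in> R S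
      then ennreal (u p \<tau> s (norm (pos N S i \<omega>)) ^ card S) else 1)"
  have Cpos: "0 < C p \<tau>"
    using params by (auto simp: valid_params_def)
  have received: "ennreal s * received p N \<tau> b t \<omega> = ennreal (s * C p \<tau> * t powr (- \<alpha> p \<tau>) * fading N b \<omega>)" for b t \<omega>
    unfolding received_def fading_def using s by (simp add: ennreal_mult'[symmetric] mult_ac)
  have c_meas: "c b \<in> borel_measurable site_sigma" if "b \<in> first_stations m" for b
  proof (cases b)
    case (BS S i n)
    then have S [measurable]: "S \<in> site_classes"
      using that by (auto simp: first_stations_def)
    note [measurable] = site_sigma_measurable[OF S] R[OF S]
    show ?thesis
      unfolding c_def BS station.case by measurable
  next
    case Colocated
    have "c Colocated = (\<lambda>_. if col then s * C p \<tau> * r powr (- \<alpha> p \<tau>) else 0)"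
      by (auto simp: c_def)
    then show ?thesis
      unfolding Colocated by (simp only: borel_measurable_const)
  qed
  have c_nonneg: "0 \<le> c b \<omega>" for b \<omega>
    using s Cpos by (auto simp: c_def split: station.splits)
  have h_meas: "h j \<in> borel_measurable position_sigma" if "j \<in> site_classes \<times> {..<m}" for j
  proof -
    from that obtain S i where j: "j = (S, i)" "S \<in> site_classes"
      by (cases j) auto
    note [measurable] = position_sigma_measurable[OF j(2)] R[OF j(2)]
    show ?thesis
      unfolding h_def j(1) prod.case by measurable
  qed
  have "(\<integral>\<^sup>+\<omega>. exp_neg (ennreal s * ((\<Sum>S\<in>site_classes. \<Sum>i<m. site_term p N \<tau> R S i \<omega>)
      + (if col then received p N \<tau> Colocated r \<omega> else 0))) \<partial>M)
    = (\<integral>\<^sup>+\<omega>. (\<Prod>b\<in>first_stations m. ennreal (exp_neg (ennreal (c b \<omega> * fading N b \<omega>)))) \<partial>M)"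
  proof (intro nn_integral_cong)
    fix \<omega>
    have "ennreal s * ((\<Sum>S\<in>site_classes. \<Sum>i<m. site_term p N \<tau> R S i \<omega>)
        + (if col then received p N \<tau> Colocated r \<omega> else 0))
      = (\<Sum>b\<in>first_stations m. ennreal (c b \<omega> * fading N b \<omega>))"
      unfolding sum_first_stations distrib_left sum_distrib_left
      by (subst add.commute, intro arg_cong2[where f = "(+)"] sum.cong refl)
         (auto simp: site_term_def c_def received sum_distrib_left)
    then show "ennreal (exp_neg (ennreal s * ((\<Sum>S\<in>site_classes. \<Sum>i<m. site_term p N \<tau> R S i \<omega>)
        + (if col then received p N \<tau> Colocated r \<omega> else 0))))
      = (\<Prod>b\<in>first_stations m. ennreal (exp_neg (ennreal (c b \<omega> * fading N b \<omega>))))"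
      by (simp add: exp_neg_sum prod_ennreal)
  qed
  also have "\<dots> = (\<integral>\<^sup>+\<omega>. (\<Prod>b\<in>first_stations m. ennreal (mark_laplace p (c b \<omega>))) \<partial>M)"
    by (intro integrate_marks first_stations c_meas c_nonneg)
  \<comment> \<open>All stations of a site have the same distance and link type, so their equal
    factors combine to the power \<open>card S\<close>.\<close>
  also have "\<dots> = (\<integral>\<^sup>+\<omega>. ennreal (if col then u p \<tau> s r else 1) *
      (\<Prod>(S, i)\<in>site_classes \<times> {..<m}. if link_type N S i \<omega> = \<tau> then h (S, i) \<omega> else 1) \<partial>M)"
    unfolding prod_first_stations
    by (intro nn_integral_cong arg_cong2[where f = "(*)"] prod.cong refl)
       (auto simp: c_def h_def u_eq_mark_laplace ennreal_power mark_laplace_bounds(1)[THEN less_imp_le] params s Cpos less_imp_le)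
  also have "\<dots> = ennreal (if col then u p \<tau> s r else 1) *
      (\<integral>\<^sup>+\<omega>. (\<Prod>(S, i)\<in>site_classes \<times> {..<m}. if link_type N S i \<omega> = \<tau> then h (S, i) \<omega> else 1) \<partial>M)"
  proof (rule nn_integral_cmult)
    have "(\<lambda>\<omega>. if link_type N (fst j) (snd j) \<omega> = \<tau> then h (fst j, snd j) \<omega> else 1) \<in> borel_measurable M"
      if j: "j \<in> site_classes \<times> {..<m}" for j
    proof -
      have S: "fst j \<in> site_classes" using j by auto
      note [measurable] = M_measurable[OF S] measurable_compose[OF position_sigma_M h_meas[OF j]]
      show ?thesis unfolding prod.collapse by measurable
    qed
    then show "(\<lambda>\<omega>. \<Prod>(S, i)\<in>site_classes \<times> {..<m}. if link_type N S i \<omega> = \<tau> then h (S, i) \<omega> else 1) \<in> borel_measurable M"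
      unfolding case_prod_unfold by (rule borel_measurable_prod_ennreal)
  qed
  also have "(\<integral>\<^sup>+\<omega>. (\<Prod>(S, i)\<in>site_classes \<times> {..<m}. if link_type N S i \<omega> = \<tau> then h (S, i) \<omega> else 1) \<partial>M)
    = (\<integral>\<^sup>+\<omega>. (\<Prod>(S, i)\<in>site_classes \<times> {..<m}.
        \<Sum>l\<in>UNIV. ennreal (link_prob p l (norm (pos N S i \<omega>))) * (if l = \<tau> then h (S, i) \<omega> else 1)) \<partial>M)"
    by (intro integrate_link_types h_meas) auto
  also have "\<dots> = (\<integral>\<^sup>+\<omega>. exp_neg (\<Sum>S\<in>site_classes. \<Sum>i<m.
      if enat i < npts N S \<omega> then cost p \<tau> s R S (pos N S i \<omega>) else 0) \<partial>M)"
  proof (rule nn_integral_cong)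
    fix \<omega>
    have "(\<Sum>l\<in>UNIV. ennreal (link_prob p l (norm (pos N S i \<omega>))) * (if l = \<tau> then h (S, i) \<omega> else 1))
        = ennreal (exp_neg (if enat i < npts N S \<omega> then cost p \<tau> s R S (pos N S i \<omega>) else 0))" for S i
    proof -
      let ?t = "norm (pos N S i \<omega>)"
      define x where "x = (if enat i < npts N S \<omega> \<and> pos N S i \<omega> \<in> R S then u p \<tau> s ?t ^ card S else 1)"
      have x: "h (S, i) \<omega> = ennreal x" "0 \<le> x"
        using u_bounds[OF params s, of \<tau>] by (auto simp: h_def x_def less_imp_le)
      have lp: "0 \<le> link_prob p l ?t" for l
        using link_prob_nonneg[OF params] by simp
      have "(\<Sum>l\<in>UNIV. ennreal (link_prob p l ?t) * (if l = \<tau> then h (S, i) \<omega> else 1))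
          = (\<Sum>l\<in>UNIV. ennreal (link_prob p l ?t * (if l = \<tau> then x else 1)))"
        using lp x by (intro sum.cong) (auto simp: ennreal_mult)
      also have "\<dots> = ennreal (\<Sum>l\<in>UNIV. link_prob p l ?t * (if l = \<tau> then x else 1))"
        using lp x by (intro sum_ennreal) auto
      \<comment> \<open>A site whose link type differs from \<open>\<tau>\<close> contributes the
        factor 1, and the link probabilities add up to 1.\<close>
      also have "(\<Sum>l\<in>UNIV. link_prob p l ?t * (if l = \<tau> then x else 1)) = 1 - link_prob p \<tau> ?t * (1 - x)"
        using link_prob_sum[of p ?t] by (cases \<tau>) (auto simp: UNIV_link algebra_simps)
      also have "\<dots> = exp_neg (if enat i < npts N S \<omega> then cost p \<tau> s R S (pos N S i \<omega>) else 0)"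
        by (auto simp: exp_neg_cost[OF params s] loss_def x_def)
      finally show ?thesis .
    qed
    then have "(\<Prod>(S, i)\<in>site_classes \<times> {..<m}.
        \<Sum>l\<in>UNIV. ennreal (link_prob p l (norm (pos N S i \<omega>))) * (if l = \<tau> then h (S, i) \<omega> else 1))
      = (\<Prod>(S, i)\<in>site_classes \<times> {..<m}. ennreal (exp_neg (if enat i < npts N S \<omega> then cost p \<tau> s R S (pos N S i \<omega>) else 0)))"
      by (simp only:)
    also have "\<dots> = ennreal (exp_neg (\<Sum>S\<in>site_classes. \<Sum>i<m. if enat i < npts N S \<omega> then cost p \<tau> s R S (pos N S i \<omega>) else 0))"
      unfolding sum.cartesian_product exp_neg_sum case_prod_unfold by (rule prod_ennreal) simp
    finally show "(\<Prod>(S, i)\<in>site_classes \<times> {..<m}.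
        \<Sum>l\<in>UNIV. ennreal (link_prob p l (norm (pos N S i \<omega>))) * (if l = \<tau> then h (S, i) \<omega> else 1))
      = ennreal (exp_neg (\<Sum>S\<in>site_classes. \<Sum>i<m. if enat i < npts N S \<omega> then cost p \<tau> s R S (pos N S i \<omega>) else 0))" .
  qed
  finally show ?thesis .
qed

lemma site_term_measurable:
  assumes S: "S \<in> site_classes" and [measurable]: "R S \<in> sets borel"
  shows "site_term p N \<tau> R S i \<in> borel_measurable M"
proof -
  have fin: "BS S i n \<in> stations" if "n \<in> S" for n
    using S that by (auto simp: stations_def)
  note [measurable] = M_measurable[OF S] marks_measurable[OF fin]
  show ?thesis
    unfolding site_term_def [abs_def] received_def by measurable
qed

text \<open>Both sides of the truncated identity converge as \<open>m\<close> grows. The series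
  always converge in \<open>ennreal\<close>, possibly to infinity, where \<open>exp_neg\<close> is
  still continuous.\<close>

lemma untruncated_laplace:
  assumes R: "\<And>S. S \<in> site_classes \<Longrightarrow> R S \<in> sets borel" and s: "0 \<le> s"
  shows "(\<integral>\<^sup>+\<omega>. exp_neg (ennreal s * ((\<Sum>S\<in>site_classes. \<Sum>i. site_term p N \<tau> R S i \<omega>)
      + (if col then received p N \<tau> Colocated r \<omega> else 0))) \<partial>M)
    = ennreal (if col then u p \<tau> s r else 1) *
      (\<integral>\<^sup>+\<omega>. exp_neg (\<Sum>S\<in>site_classes. \<Sum>i. if enat i < npts N S \<omega> then cost p \<tau> s R S (pos N S i \<omega>) else 0) \<partial>M)"
proof (rule LIMSEQ_unique)
  have Col: "Colocated \<in> stations"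
    by (simp add: stations_def)
  have [measurable]: "received p N \<tau> Colocated r \<in> borel_measurable M"
    unfolding received_def [abs_def] using marks_measurable[OF Col] by measurable
  have st [measurable]: "S \<in> site_classes \<Longrightarrow> site_term p N \<tau> R S i \<in> borel_measurable M" for S i
    using R by (intro site_term_measurable)
  have co [measurable]: "(\<lambda>\<omega>. if enat i < npts N S \<omega> then cost p \<tau> s R S (pos N S i \<omega>) else 0) \<in> borel_measurable M"
    if S: "S \<in> site_classes" for S i
  proof -
    note [measurable] = M_measurable[OF S] cost_measurable[where R = R, OF R[OF S]]
    show ?thesis by measurable
  qed
  let ?L = "\<lambda>m. \<integral>\<^sup>+\<omega>. exp_neg (ennreal s * ((\<Sum>S\<in>site_classes. \<Sum>i<m. site_term p N \<tau> R S i \<omega>)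
      + (if col then received p N \<tau> Colocated r \<omega> else 0))) \<partial>M"
  show "?L \<longlonglongrightarrow> (\<integral>\<^sup>+\<omega>. exp_neg (ennreal s * ((\<Sum>S\<in>site_classes. \<Sum>i. site_term p N \<tau> R S i \<omega>)
      + (if col then received p N \<tau> Colocated r \<omega> else 0))) \<partial>M)"
    by (intro nn_integral_exp_neg_tendsto prob_space_axioms ennreal_tendsto_cmult tendsto_add tendsto_sum
        summable_LIMSEQ tendsto_const) auto
  have eq: "?L = (\<lambda>m. ennreal (if col then u p \<tau> s r else 1) *
      (\<integral>\<^sup>+\<omega>. exp_neg (\<Sum>S\<in>site_classes. \<Sum>i<m. if enat i < npts N S \<omega> then cost p \<tau> s R S (pos N S i \<omega>) else 0) \<partial>M))"
    by (intro ext truncated_laplace R s)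
  show "?L \<longlonglongrightarrow> ennreal (if col then u p \<tau> s r else 1) *
      (\<integral>\<^sup>+\<omega>. exp_neg (\<Sum>S\<in>site_classes. \<Sum>i. if enat i < npts N S \<omega> then cost p \<tau> s R S (pos N S i \<omega>) else 0) \<partial>M)"
    unfolding eq
    by (intro ennreal_tendsto_cmult nn_integral_exp_neg_tendsto prob_space_axioms tendsto_sum summable_LIMSEQ
        borel_measurable_sum borel_measurable_suminf_order co) auto
qed

text \<open>The sum over the points of one class depends only on the events of that class, so
  independence of the classes factors the expectation; each factor is a Poisson Laplace
  functional.\<close>

lemma site_classes_laplace:
  assumes R: "\<And>S. S \<in> site_classes \<Longrightarrow> R S \<in> sets borel" and s: "0 \<le> s"
  shows "(\<integral>\<^sup>+\<omega>. exp_neg (\<Sum>S\<in>site_classes. \<Sum>i. if enat i < npts N S \<omega> then cost p \<tau> s R S (pos N S i \<omega>) else 0) \<partial>M)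
    = exp_neg (\<Sum>S\<in>site_classes. ennreal (dens p S) * (\<integral>\<^sup>+y. ennreal (loss p \<tau> s R S y) \<partial>lborel))"
proof -
  define X where "X S \<omega> = (\<Sum>i. if enat i < npts N S \<omega> then cost p \<tau> s R S (pos N S i \<omega>) else 0)" for S \<omega>
  have X_class: "X S \<in> borel_measurable (class_sigma S)" if S: "S \<in> site_classes" for S
  proof -
    note [measurable] = cost_measurable[where R = R, OF R[OF S]]
    show ?thesis unfolding X_def [abs_def] by measurable
  qed
  have "indep_vars (\<lambda>_. borel) X site_classes"
    unfolding indep_vars_def2
  proof
    show "\<forall>S\<in>site_classes. random_variable borel (X S)"
    proof
      fix S assume S: "S \<in> site_classes"
      note [measurable] = M_measurable[OF S] cost_measurable[where R = R, OF R[OF S]]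
      show "random_variable borel (X S)"
        unfolding X_def [abs_def] by measurable
    qed
    have "indep_sets (class_events M N) site_classes"
      using network by (simp add: is_network_def)
    then show "indep_sets (\<lambda>S. {X S -` A \<inter> space M |A. A \<in> sets borel}) site_classes"
    proof (rule indep_sets_mono_sets)
      fix S assume "S \<in> site_classes"
      then show "{X S -` A \<inter> space M |A. A \<in> sets borel} \<subseteq> class_events M N S"
        using measurable_sets[OF X_class] by auto
    qed
  qed
  note ind = indep_vars_compose2[OF this, where Y = "\<lambda>_ x. ennreal (exp_neg x)" and N = "\<lambda>_. borel"]
  have "(\<integral>\<^sup>+\<omega>. exp_neg (\<Sum>S\<in>site_classes. X S \<omega>) \<partial>M) = (\<integral>\<^sup>+\<omega>. (\<Prod>S\<in>site_classes. ennreal (exp_neg (X S \<omega>))) \<partial>M)"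
    by (simp add: exp_neg_sum prod_ennreal)
  also have "\<dots> = (\<Prod>S\<in>site_classes. \<integral>\<^sup>+\<omega>. ennreal (exp_neg (X S \<omega>)) \<partial>M)"
    by (intro indep_vars_nn_integral ind) auto
  also have "\<dots> = (\<Prod>S\<in>site_classes. ennreal (exp_neg (ennreal (dens p S) * (\<integral>\<^sup>+y. ennreal (loss p \<tau> s R S y) \<partial>lborel))))"
  proof (intro prod.cong refl)
    fix S assume S: "S \<in> site_classes"
    have "homogeneous_PPP M (dens p S) (npts N S) (pos N S)" "0 \<le> dens p S"
      using network params S by (auto simp: is_network_def valid_params_def)
    from PPP_laplace[OF this cost_measurable[where R = R, OF R[OF S]], of p \<tau> s]
    show "(\<integral>\<^sup>+\<omega>. ennreal (exp_neg (X S \<omega>)) \<partial>M)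
        = ennreal (exp_neg (ennreal (dens p S) * (\<integral>\<^sup>+y. ennreal (loss p \<tau> s R S y) \<partial>lborel)))"
      by (simp add: X_def exp_neg_cost[OF params s])
  qed
  finally show ?thesis
    unfolding X_def by (simp add: exp_neg_sum prod_ennreal)
qed

end

section \<open>Regions of interferers and integrals in polar coordinates\<close>

lemma zone_radius_nonneg: "0 \<le> zone_radius p sch x \<tau>"
  by (cases x) (auto intro!: integral_nonneg)

definition region :: "params \<Rightarrow> scheme \<Rightarrow> link \<Rightarrow> real \<Rightarrow> link \<Rightarrow> interferer \<Rightarrow> nat set \<Rightarrow> (real^2) set" where
  "region p sch \<tau>0 r \<tau> x S = {y. allowed p \<tau>0 r S \<tau> (norm y) \<and> y \<notin> zone p sch \<tau> x}"

definition inner_radius :: "params \<Rightarrow> link \<Rightarrow> real \<Rightarrow> link \<Rightarrow> real" where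
  "inner_radius p \<tau>0 r \<tau> = (if \<tau> = \<tau>0 then r else D p \<tau> r)"

text \<open>Zones are balls about the origin, so zone and association both restrict the distance
  alone. This makes the exponent a radial integral.\<close>

lemma region_eq:
  "region p sch \<tau>0 r \<tau> x S = {y. zone_radius p sch x \<tau> < norm y \<and> (1 \<in> S \<longrightarrow> inner_radius p \<tau>0 r \<tau> < norm y)}"
  by (auto simp: region_def allowed_def zone_def inner_radius_def)

lemma region_measurable: "region p sch \<tau>0 r \<tau> x S \<in> sets borel"
  unfolding region_eq by measurable

lemma interference_component_eq:
  "interference_component p sch S0 \<tau>0 r \<tau> x N \<omega> =
     (\<Sum>S\<in>site_classes. \<Sum>i. site_term p N \<tau> (region p sch \<tau>0 r \<tau> x) S i \<omega>) +
     (if S0 = {1, 2} \<and> \<tau>0 = \<tau> \<and> \<not> in_zone p sch \<tau> x r then received p N \<tau> Colocated r \<omega> else 0)"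
  unfolding interference_component_def site_term_def region_def by simp

text \<open>The integrals over the open and the closed half line agree since a point is a null set.\<close>

lemma loss_integral:
  assumes p: "valid_params p" "0 \<le> s" and b: "0 \<le> b"
    and R: "R S = {y. b < norm y}"
  shows "(\<integral>\<^sup>+y. ennreal (loss p \<tau> s R S y) \<partial>lborel)
    = ennreal (2 * pi) * tail_integral b (\<lambda>t. (1 - u p \<tau> s t ^ card S) * t * link_prob p \<tau> t)"
proof -
  define f where "f t = ennreal (if b < t then link_prob p \<tau> t * (1 - u p \<tau> s t ^ card S) else 0)" for t
  have [measurable]: "f \<in> borel_measurable borel"
    unfolding f_def [abs_def] by measurable
  have "(\<integral>\<^sup>+y. ennreal (loss p \<tau> s R S y) \<partial>lborel) = (\<integral>\<^sup>+y. f (norm y) \<partial>(lborel :: (real^2) measure))"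
    by (simp add: loss_def f_def R)
  also have "\<dots> = ennreal (2 * pi) * (\<integral>\<^sup>+t\<in>{0..}. (f t * ennreal t) \<partial>lborel)"
    by (rule nn_integral_radial) measurable
  also have "(\<integral>\<^sup>+t\<in>{0..}. (f t * ennreal t) \<partial>lborel)
      = tail_integral b (\<lambda>t. (1 - u p \<tau> s t ^ card S) * t * link_prob p \<tau> t)"
    unfolding tail_integral_def
  proof (rule nn_integral_cong_AE)
    have "AE t in lborel. t \<noteq> b"
      by (rule AE_lborel_singleton)
    then show "AE t in lborel. f t * ennreal t * indicator {0..} t
        = ennreal ((1 - u p \<tau> s t ^ card S) * t * link_prob p \<tau> t) * indicator {b..} t"
    proof eventually_elim
      case (elim t)
      show ?case
      proof (cases "b < t")
        case True
        then have "0 \<le> t" using b by simp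
        moreover have "0 \<le> link_prob p \<tau> t" "0 \<le> 1 - u p \<tau> s t ^ card S"
          using link_prob_nonneg[OF p(1) \<open>0 \<le> t\<close>] u_bounds(2)[OF p] less_imp_le[OF u_bounds(1)[OF p]]
          by (auto intro: power_le_one)
        ultimately show ?thesis
          using True by (simp add: f_def mult_ac flip: ennreal_mult)
      qed (use elim b in \<open>auto simp: f_def\<close>)
    qed
  qed
  finally show ?thesis .
qed

text \<open>Classes \<open>{1}\<close> and \<open>{1, 2}\<close> obey both the zone and the
  association bound, hence the maximum as lower limit; class \<open>{2}\<close> obeys only the zone.
  The indices 1 and 2 of \<open>w\<close> are the numbers of stations per site.\<close>

lemma (in network_model) component_laplace:
  fixes sch :: scheme and \<tau> \<tau>0 :: link and x :: interferer
  assumes s: "0 \<le> s"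
  defines "w \<equiv> \<lambda>k t. (1 - u p \<tau> s t ^ k) * t * link_prob p \<tau> t"
    and "b \<equiv> zone_radius p sch x \<tau>"
  shows "(\<integral>\<^sup>+\<omega>. exp_neg (ennreal s * interference_component p sch S0 \<tau>0 r \<tau> x N \<omega>) \<partial>M)
    = ennreal (if S0 = {1, 2} \<and> \<tau>0 = \<tau> then u_zone p sch \<tau> x s r else 1) *
      exp_neg (ennreal (2 * pi) *
        (ennreal (dens p {1}) * tail_integral (max (inner_radius p \<tau>0 r \<tau>) b) (w 1)
         + ennreal (dens p {2}) * tail_integral b (w 1)
         + ennreal (dens p {1, 2}) * tail_integral (max (inner_radius p \<tau>0 r \<tau>) b) (w 2)))"
proof -
  let ?R = "region p sch \<tau>0 r \<tau> x"
  let ?i = "inner_radius p \<tau>0 r \<tau>"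
  have b: "0 \<le> b"
    unfolding b_def by (rule zone_radius_nonneg)
  have I: "(\<integral>\<^sup>+y. ennreal (loss p \<tau> s ?R S y) \<partial>lborel)
      = ennreal (2 * pi) * tail_integral (if 1 \<in> S then max ?i b else b) (w (card S))" for S
    unfolding w_def using b by (intro loss_integral params s) (auto simp: region_eq b_def)
  have "(\<integral>\<^sup>+\<omega>. exp_neg (ennreal s * interference_component p sch S0 \<tau>0 r \<tau> x N \<omega>) \<partial>M)
    = ennreal (if S0 = {1, 2} \<and> \<tau>0 = \<tau> \<and> \<not> in_zone p sch \<tau> x r then u p \<tau> s r else 1) *
      exp_neg (\<Sum>S\<in>site_classes. ennreal (dens p S) * (\<integral>\<^sup>+y. ennreal (loss p \<tau> s ?R S y) \<partial>lborel))"
    unfolding interference_component_eq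
    by (subst untruncated_laplace[OF region_measurable s], subst site_classes_laplace[OF region_measurable s]) (rule refl)
  also have "(if S0 = {1, 2} \<and> \<tau>0 = \<tau> \<and> \<not> in_zone p sch \<tau> x r then u p \<tau> s r else 1)
      = (if S0 = {1, 2} \<and> \<tau>0 = \<tau> then u_zone p sch \<tau> x s r else 1)"
    by (simp add: u_zone_def)
  also have "(\<Sum>S\<in>site_classes. ennreal (dens p S) * (\<integral>\<^sup>+y. ennreal (loss p \<tau> s ?R S y) \<partial>lborel))
    = ennreal (2 * pi) *
        (ennreal (dens p {1}) * tail_integral (max ?i b) (w 1)
         + ennreal (dens p {2}) * tail_integral b (w 1)
         + ennreal (dens p {1, 2}) * tail_integral (max ?i b) (w 2))"
  proof -
    have "{1::nat} \<noteq> {2}" "{1::nat} \<noteq> {1, 2}" "{2::nat} \<noteq> {1, 2}"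
      by auto
    then have "(\<Sum>S\<in>site_classes. f S) = f {1} + f {2} + f {1, 2}" for f :: "nat set \<Rightarrow> ennreal"
      unfolding site_classes_def by (simp add: add.assoc)
    then show ?thesis
      by (simp add: I distrib_left mult_ac numeral_2_eq_2)
  qed
  finally show ?thesis .
qed

section \<open>Tail integrals and assembly of the four components\<close>

lemma tail_integral_add:
  assumes "f \<in> borel_measurable borel" "g \<in> borel_measurable borel"
    and "\<And>t. b \<le> t \<Longrightarrow> 0 \<le> f t" "\<And>t. b \<le> t \<Longrightarrow> 0 \<le> g t"
  shows "tail_integral b (\<lambda>t. f t + g t) = tail_integral b f + tail_integral b g"
proof -
  note [measurable] = assms(1,2)
  have "tail_integral b (\<lambda>t. f t + g t)
      = (\<integral>\<^sup>+t. ennreal (f t) * indicator {b..} t + ennreal (g t) * indicator {b..} t \<partial>lborel)"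
    unfolding tail_integral_def using assms(3,4)
    by (intro nn_integral_cong) (auto split: split_indicator)
  also have "\<dots> = tail_integral b f + tail_integral b g"
    unfolding tail_integral_def by (rule nn_integral_add) auto
  finally show ?thesis .
qed

lemma tail_integral_cmult:
  assumes "f \<in> borel_measurable borel" "0 \<le> c"
  shows "tail_integral b (\<lambda>t. c * f t) = ennreal c * tail_integral b f"
proof -
  note [measurable] = assms(1)
  have "tail_integral b (\<lambda>t. c * f t) = (\<integral>\<^sup>+t. ennreal c * (ennreal (f t) * indicator {b..} t) \<partial>lborel)"
    unfolding tail_integral_def using assms(2)
    by (intro nn_integral_cong) (auto simp: ennreal_mult' split: split_indicator)
  also have "\<dots> = ennreal c * tail_integral b f"
    unfolding tail_integral_def by (rule nn_integral_cmult) auto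
  finally show ?thesis .
qed

lemma tail_integral_cong:
  "(\<And>t. b \<le> t \<Longrightarrow> f t = g t) \<Longrightarrow> tail_integral b f = tail_integral b g"
  unfolding tail_integral_def by (intro nn_integral_cong) (auto split: split_indicator)

lemma UNIV_interferer: "(UNIV :: interferer set) = {Hidden, Deaf}"
  using interferer.exhaust by auto

text \<open>The four components are independent, so the expectation factors over the pairs of link
  type and interferer kind. The Bochner integral of the definition may be replaced by a nonnegative
  one because \<open>exp_neg\<close> is bounded.\<close>

lemma conditional_laplace:
  fixes sch :: scheme and \<tau>0 :: link
  assumes model: "conditional_model M p sch S0 \<tau>0 r N"
    and s: "0 \<le> s"
  defines "E \<equiv> \<lambda>\<tau> x. \<integral>\<^sup>+\<omega>. exp_neg (ennreal s * interference_component p sch S0 \<tau>0 r \<tau> x (N \<tau> x) \<omega>) \<partial>M"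
  shows "ennreal (laplace_transform M (interference p sch S0 \<tau>0 r N) s)
    = E LoS Hidden * E LoS Deaf * E NLoS Hidden * E NLoS Deaf"
proof -
  define X where "X = (\<lambda>(\<tau>, x). interference_component p sch S0 \<tau>0 r \<tau> x (N \<tau> x))"
  interpret prob_space M
    using model by (simp add: conditional_model_def)
  have ind: "indep_vars (\<lambda>_. borel) X UNIV"
    using model by (simp add: conditional_model_def X_def)
  have UNIV_eq: "(UNIV :: (link \<times> interferer) set) = {(LoS, Hidden), (LoS, Deaf), (NLoS, Hidden), (NLoS, Deaf)}"
    by (auto simp: UNIV_link UNIV_interferer simp flip: UNIV_Times_UNIV)
  have X_meas [measurable]: "X j \<in> borel_measurable M" for j
    using ind unfolding indep_vars_def2 by blast
  have I_eq: "interference p sch S0 \<tau>0 r N \<omega> = (\<Sum>j\<in>UNIV. X j \<omega>)" for \<omega>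
    unfolding interference_def UNIV_eq X_def by (simp add: add.assoc)
  have [measurable]: "interference p sch S0 \<tau>0 r N \<in> borel_measurable M"
    unfolding I_eq [abs_def] by measurable
  have "ennreal (laplace_transform M (interference p sch S0 \<tau>0 r N) s)
      = (\<integral>\<^sup>+\<omega>. exp_neg (ennreal s * interference p sch S0 \<tau>0 r N \<omega>) \<partial>M)"
    unfolding laplace_transform_def
    by (intro nn_integral_eq_integral[symmetric] integrable_const_bound[where B = 1]) auto
  also have "\<dots> = (\<integral>\<^sup>+\<omega>. (\<Prod>j\<in>UNIV. ennreal (exp_neg (ennreal s * X j \<omega>))) \<partial>M)"
    unfolding I_eq by (simp add: sum_distrib_left exp_neg_sum prod_ennreal)
  also have "\<dots> = (\<Prod>j\<in>UNIV. \<integral>\<^sup>+\<omega>. ennreal (exp_neg (ennreal s * X j \<omega>)) \<partial>M)"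
    by (intro indep_vars_nn_integral indep_vars_compose2[OF ind, where Y = "\<lambda>j x. ennreal (exp_neg (ennreal s * x))"])
      (auto simp: UNIV_eq)
  also have "\<dots> = E LoS Hidden * E LoS Deaf * E NLoS Hidden * E NLoS Deaf"
    unfolding UNIV_eq E_def X_def by (simp add: mult.assoc)
  finally show ?thesis .
qed

lemma interference_laplace:
  fixes sch :: scheme and \<tau>0 :: link
  assumes p: "valid_params p"
    and \<rho>: "0 \<le> \<rho>" "dens p {1, 2} = \<rho> * lam" "lam = operator_density p 1 + operator_density p 2 - \<rho> * lam"
    and lam: "0 < lam" and a: "a = operator_density p 1 / lam"
    and s: "0 \<le> s"
    and model: "conditional_model M p sch S0 \<tau>0 r N"
  defines "V \<equiv> \<lambda>\<tau> t. (1 - u p \<tau> s t) * t * link_prob p \<tau> t"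
    and "W \<equiv> \<lambda>\<tau> t. (1 - u p \<tau> s t) * (a + \<rho> * u p \<tau> s t) * t * link_prob p \<tau> t"
  defines "Q \<equiv> \<lambda>\<tau> x. tail_integral (zone_radius p sch x \<tau>) (\<lambda>t. (1 - a) * V \<tau> t)
      + tail_integral (max (inner_radius p \<tau>0 r \<tau>) (zone_radius p sch x \<tau>)) (W \<tau>)"
  shows "laplace_transform M (interference p sch S0 \<tau>0 r N) s
    = (if S0 = {1, 2} then u_zone p sch \<tau>0 Hidden s r * u_zone p sch \<tau>0 Deaf s r else 1) *
      exp_neg (ennreal (2 * pi * lam) * (Q LoS Hidden + Q LoS Deaf + Q NLoS Hidden + Q NLoS Deaf))"
proof -
  \<comment> \<open>Operator 1 has density \<open>a * lam\<close>, of which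
    \<open>\<rho> * lam\<close> is shared. The three class densities add up to \<open>lam\<close>,
    so class \<open>{2}\<close> has what operator 1 leaves.\<close>
  have dens: "dens p {1} = (a - \<rho>) * lam" "dens p {2} = (1 - a) * lam"
  proof -
    have "a * lam = dens p {1} + dens p {1, 2}"
      using lam by (simp add: a operator_density_def)
    then show "dens p {1} = (a - \<rho>) * lam" "dens p {2} = (1 - a) * lam"
      using \<rho>(2,3) unfolding operator_density_def left_diff_distrib by linarith+
  qed
  have "0 \<le> dens p {1}" "0 \<le> dens p {2}"
    using p by (auto simp: valid_params_def site_classes_def)
  \<comment> \<open>The signs matter because \<open>ennreal\<close> truncates negative numbers to 0:
    the coefficients must be nonnegative to be pulled through the tail integrals.\<close>
  then have a_bounds: "0 \<le> a - \<rho>" "0 \<le> 1 - a"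
    unfolding dens using lam by (auto simp: zero_le_mult_iff)
  define w where "w k \<tau> t = (1 - u p \<tau> s t ^ k) * t * link_prob p \<tau> t" for k :: nat and \<tau> t
  have w_meas: "w k \<tau> \<in> borel_measurable borel" for k \<tau>
    unfolding w_def [abs_def] by measurable
  have w_nonneg: "0 \<le> w k \<tau> t" if "0 \<le> t" for k \<tau> t
    using that link_prob_nonneg[OF p that] power_le_one[OF less_imp_le[OF u_bounds(1)[OF p s]] u_bounds(2)[OF p s]]
    by (auto simp: w_def)
  have Q_eq: "ennreal (dens p {1}) * tail_integral (max i b) (w 1 \<tau>) + ennreal (dens p {2}) * tail_integral b (w 1 \<tau>)
      + ennreal (dens p {1, 2}) * tail_integral (max i b) (w 2 \<tau>)
    = ennreal lam * (tail_integral b (\<lambda>t. (1 - a) * V \<tau> t) + tail_integral (max i b) (W \<tau>))"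
    if b: "0 \<le> b" for i b \<tau>
  proof -
    have V: "tail_integral b (\<lambda>t. (1 - a) * V \<tau> t) = ennreal (1 - a) * tail_integral b (w 1 \<tau>)"
      using tail_integral_cmult[OF w_meas a_bounds(2), of b 1 \<tau>] by (simp add: V_def w_def)
    \<comment> \<open>\<open>W\<close> is split into a combination with nonnegative coefficients,
      one term per class used by operator 1, since integrals in \<open>ennreal\<close> cannot be
      subtracted.\<close>
    have "tail_integral (max i b) (W \<tau>) = tail_integral (max i b) (\<lambda>t. (a - \<rho>) * w 1 \<tau> t + \<rho> * w 2 \<tau> t)"
      by (intro tail_integral_cong) (simp add: W_def w_def power2_eq_square algebra_simps)
    also have "\<dots> = tail_integral (max i b) (\<lambda>t. (a - \<rho>) * w 1 \<tau> t) + tail_integral (max i b) (\<lambda>t. \<rho> * w 2 \<tau> t)"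
      using b a_bounds \<rho>(1) w_nonneg w_meas by (intro tail_integral_add) auto
    also have "\<dots> = ennreal (a - \<rho>) * tail_integral (max i b) (w 1 \<tau>) + ennreal \<rho> * tail_integral (max i b) (w 2 \<tau>)"
      using a_bounds \<rho>(1) w_meas by (simp add: tail_integral_cmult)
    finally have W: "tail_integral (max i b) (W \<tau>)
      = ennreal (a - \<rho>) * tail_integral (max i b) (w 1 \<tau>) + ennreal \<rho> * tail_integral (max i b) (w 2 \<tau>)" .
    show ?thesis
      unfolding V W dens \<rho>(2) using a_bounds \<rho>(1) lam
      by (simp add: ennreal_mult distrib_left mult_ac add_ac)
  qed
  \<comment> \<open>The factor of the co-located station. It shares the serving link type, so only
    the hidden and the deaf component of type \<open>\<tau>0\<close> can have a factor other than
    1.\<close>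
  define c where "c \<tau> x = (if S0 = {1, 2} \<and> \<tau>0 = \<tau> then u_zone p sch \<tau> x s r else 1)" for \<tau> x
  have c_nonneg: "0 \<le> c \<tau> x" for \<tau> x
    using u_bounds(1)[OF p s] by (auto simp: c_def u_zone_def less_imp_le)
  have comp: "(\<integral>\<^sup>+\<omega>. exp_neg (ennreal s * interference_component p sch S0 \<tau>0 r \<tau> x (N \<tau> x) \<omega>) \<partial>M)
    = ennreal (c \<tau> x * exp_neg (ennreal (2 * pi * lam) * Q \<tau> x))" for \<tau> x
  proof -
    have "prob_space M" "is_network M p (N \<tau> x)"
      using model by (auto simp: conditional_model_def)
    then interpret network_model M p "N \<tau> x"
      by (intro network_model.intro network_model_axioms.intro p)
    show ?thesis
      unfolding component_laplace[OF s] w_def[symmetric] Q_eq[OF zone_radius_nonneg] Q_def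
      using c_nonneg[of \<tau> x] lam by (simp add: c_def ennreal_mult mult.assoc)
  qed
  \<comment> \<open>The four exponents merge by \<open>exp_neg_add\<close>, which holds for infinite
    values too; nonnegativity of both sides then permits the return to the reals.\<close>
  have "ennreal (laplace_transform M (interference p sch S0 \<tau>0 r N) s)
    = ennreal (c LoS Hidden * c LoS Deaf * c NLoS Hidden * c NLoS Deaf *
        exp_neg (ennreal (2 * pi * lam) * (Q LoS Hidden + Q LoS Deaf + Q NLoS Hidden + Q NLoS Deaf)))"
    unfolding conditional_laplace[OF model s] comp
    using c_nonneg by (simp add: distrib_left distrib_right exp_neg_add mult_ac flip: ennreal_mult)
  moreover have "0 \<le> laplace_transform M (interference p sch S0 \<tau>0 r N) s"
    unfolding laplace_transform_def by (intro Bochner_Integration.integral_nonneg) auto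
  ultimately have "laplace_transform M (interference p sch S0 \<tau>0 r N) s
    = c LoS Hidden * c LoS Deaf * c NLoS Hidden * c NLoS Deaf *
        exp_neg (ennreal (2 * pi * lam) * (Q LoS Hidden + Q LoS Deaf + Q NLoS Hidden + Q NLoS Deaf))"
    using c_nonneg by (subst (asm) ennreal_inj) auto
  also have "c LoS Hidden * c LoS Deaf * c NLoS Hidden * c NLoS Deaf
    = (if S0 = {1, 2} then u_zone p sch \<tau>0 Hidden s r * u_zone p sch \<tau>0 Deaf s r else 1)"
    by (cases \<tau>0) (auto simp: c_def)
  finally show ?thesis .
qed

theorem corollary2:
  fixes p :: params and sch :: scheme
    and lam \<rho> a r Z sL sN :: real
    and h d :: "link \<Rightarrow> real"
    and V W :: "link \<Rightarrow> real \<Rightarrow> real \<Rightarrow> real"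
    and P :: "nat set \<Rightarrow> link \<Rightarrow> 'w measure"
    and N :: "nat set \<Rightarrow> link \<Rightarrow> link \<Rightarrow> interferer \<Rightarrow> 'w network"
    and Lap :: "nat set \<Rightarrow> link \<Rightarrow> real \<Rightarrow> real"
  assumes "valid_params p"
    and "0 \<le> \<rho>" "\<rho> \<le> 1"
    and "dens p {1, 2} = \<rho> * lam"
    and "lam = operator_density p 1 + operator_density p 2 - \<rho> * lam"
    and "0 < lam"
    and "a = operator_density p 1 / lam"
    and "0 < r" "0 < Z"
    and "sL = r powr \<alpha> p LoS * Z / (C p LoS * M_BS p * M_UE p)"
    and "sN = r powr \<alpha> p NLoS * Z / (C p NLoS * M_BS p * M_UE p)"
    and "\<And>\<tau>. h \<tau> = zone_radius p sch Hidden \<tau>"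
    and "\<And>\<tau>. d \<tau> = zone_radius p sch Deaf \<tau>"
    and "\<And>\<tau> s t. V \<tau> s t = (1 - u p \<tau> s t) * t * link_prob p \<tau> t"
    and "\<And>\<tau> s t. W \<tau> s t = (1 - u p \<tau> s t) * (a + \<rho> * u p \<tau> s t) * t * link_prob p \<tau> t"
    and "\<And>S \<tau>. S \<in> {{1}, {1, 2}} \<Longrightarrow> conditional_model (P S \<tau>) p sch S \<tau> r (N S \<tau>)"
    and "\<And>S \<tau> s. Lap S \<tau> s = laplace_transform (P S \<tau>) (interference p sch S \<tau> r (N S \<tau>)) s"
  shows "Lap {1} LoS sL = exp_neg (ennreal (2 * pi * lam) *
            (tail_integral (h LoS) (\<lambda>t. (1 - a) * V LoS sL t)
           + tail_integral (d LoS) (\<lambda>t. (1 - a) * V LoS sL t)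
           + tail_integral (max r (h LoS)) (\<lambda>t. W LoS sL t)
           + tail_integral (max r (d LoS)) (\<lambda>t. W LoS sL t)
           + tail_integral (h NLoS) (\<lambda>t. (1 - a) * V NLoS sL t)
           + tail_integral (d NLoS) (\<lambda>t. (1 - a) * V NLoS sL t)
           + tail_integral (max (D p NLoS r) (h NLoS)) (\<lambda>t. W NLoS sL t)
           + tail_integral (max (D p NLoS r) (d NLoS)) (\<lambda>t. W NLoS sL t))) \<and>
         Lap {1, 2} LoS sL =
           u_zone p sch LoS Hidden sL r * u_zone p sch LoS Deaf sL r * Lap {1} LoS sL \<and>
         Lap {1} NLoS sN = exp_neg (ennreal (2 * pi * lam) *
            (tail_integral (h NLoS) (\<lambda>t. (1 - a) * V NLoS sN t)
           + tail_integral (d NLoS) (\<lambda>t. (1 - a) * V NLoS sN t)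
           + tail_integral (max r (h NLoS)) (\<lambda>t. W NLoS sN t)
           + tail_integral (max r (d NLoS)) (\<lambda>t. W NLoS sN t)
           + tail_integral (h LoS) (\<lambda>t. (1 - a) * V LoS sN t)
           + tail_integral (d LoS) (\<lambda>t. (1 - a) * V LoS sN t)
           + tail_integral (max (D p LoS r) (h LoS)) (\<lambda>t. W LoS sN t)
           + tail_integral (max (D p LoS r) (d LoS)) (\<lambda>t. W LoS sN t))) \<and>
         Lap {1, 2} NLoS sN =
           u_zone p sch NLoS Hidden sN r * u_zone p sch NLoS Deaf sN r * Lap {1} NLoS sN"
proof -
  note p = assms(1) and V = assms(14) and W = assms(15) and Lap = assms(17)
  note hd = assms(12,13)
  have MC: "0 < C p LoS" "0 < C p NLoS" "0 < M_BS p" "0 < M_UE p"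
    using p by (auto simp: valid_params_def)
  have s: "0 \<le> sL" "0 \<le> sN"
    unfolding assms(10,11) using \<open>0 < Z\<close> MC by auto
  have ne: "{1::nat} \<noteq> {1, 2}"
    by auto
  have V': "V \<tau> s = (\<lambda>t. (1 - u p \<tau> s t) * t * link_prob p \<tau> t)"
    and W': "W \<tau> s = (\<lambda>t. (1 - u p \<tau> s t) * (a + \<rho> * u p \<tau> s t) * t * link_prob p \<tau> t)" for \<tau> s
    by (auto simp: V W)
  \<comment> \<open>The spaces \<open>P {1} \<tau>\<close> and \<open>P {1, 2} \<tau>\<close> need
    not be related. The claims for \<open>{1, 2}\<close> follow because both transforms are given by
    one expression in the parameters, which differs only in the factor of the co-located
    station.\<close>
  have formula: "Lap S \<tau> s = (if S = {1, 2} then u_zone p sch \<tau> Hidden s r * u_zone p sch \<tau> Deaf s r else 1) *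
      exp_neg (ennreal (2 * pi * lam) *
        ((tail_integral (h LoS) (\<lambda>t. (1 - a) * V LoS s t) + tail_integral (max (inner_radius p \<tau> r LoS) (h LoS)) (W LoS s))
         + (tail_integral (d LoS) (\<lambda>t. (1 - a) * V LoS s t) + tail_integral (max (inner_radius p \<tau> r LoS) (d LoS)) (W LoS s))
         + (tail_integral (h NLoS) (\<lambda>t. (1 - a) * V NLoS s t) + tail_integral (max (inner_radius p \<tau> r NLoS) (h NLoS)) (W NLoS s))
         + (tail_integral (d NLoS) (\<lambda>t. (1 - a) * V NLoS s t) + tail_integral (max (inner_radius p \<tau> r NLoS) (d NLoS)) (W NLoS s))))"
    if "S \<in> {{1}, {1, 2}}" "0 \<le> s" for S \<tau> s
    unfolding Lap V' W' hd
    by (rule interference_laplace[OF p assms(2,4,5,6,7) that(2) assms(16)[OF that(1)]])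
  have inner: "inner_radius p LoS r LoS = r" "inner_radius p LoS r NLoS = D p NLoS r"
    "inner_radius p NLoS r LoS = D p LoS r" "inner_radius p NLoS r NLoS = r"
    by (simp_all add: inner_radius_def)
  show ?thesis
    using ne by (simp only: formula[OF _ s(1)] formula[OF _ s(2)] inner insert_iff simp_thms if_True if_False mult_1_left add_ac)
qed

end
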